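(* Consider the system under the PULL algorithm (either version, PULL-1 or PULL-2). If $B_j<\infty$ for all $j\in\mathcal{J}$, then (for any $n$) the Markov process $s^n(\cdot)$ is ergodic.
   Context: Model. There are $J\ge 1$ server pools, indexed by $j\in\mathcal{J}=\{1,\dots,J\}$; pool $j$ consists of $N_j$ identical servers, $\mathcal{N}_j$ denotes the set of servers in pool $j$, and $\mathcal{N}=\cup_j\mathcal{N}_j$. Service times are independent; at a server of pool $j$ they are exponential with mean $1/\mu_j\in(0,\infty)$. Each server serves its queue in first-come-first-serve order (only the head-of-line customer is served). The buffer size (maximum queue length, including the customer in service) at a server of pool $j$ is $B_j\in\{1,2,\dots\}\cup\{\infty\}$; a customer sent to a server in pool $j$ whose queue length equals the finite value $B_j$ is blocked (lost). Customers arrive as a Poisson process of rate $\Lambda$; each arriving customer is assigned uniformly at random, independently, to one of $R\ge1$ routers $r\in\mathcal{R}=\{1,\dots,R\}$, which must immediately send it to a server or block it (so arrivals to the routers are independent Poisson processes of rate $\Lambda/R$). Scaling. $n=\sum_j N_j$ is the total number of servers; $\Lambda=\lambda n$, $N_j=\beta_j n$, with fixed constants $\lambda>0,\beta_j>0$, $\sum_j\beta_j=1$; only values of $n$ with all $\beta_j n$ integer are considered. It is assumed that $\lambda<\sum_j\beta_j\mu_j$. $J$, $R$, $\mu_j$, $B_j$ do not depend on $n$. PULL algorithm. (a) At any time each idle server has exactly one pull-message, located at one of the routers; a pull-message at router $r$ is called an $r$-pull-message. (b) When a server becomes idle after a service completion, a pull-message from it is placed at a router chosen uniformly at random. (c)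 When a customer arrives at an idle server, that server's pull-message is destroyed (wherever it is located). (d) When a customer arrives at router $r$ and there are $r$-pull-messages, the customer is sent to one of the corresponding idle servers, chosen uniformly at random. If there are no $r$-pull-messages: (e.1) under PULL-1 the customer is blocked and lost; (e.2) under PULL-2 the customer is sent to a server chosen uniformly at random among all servers in the system (where it is blocked if that server's buffer is full). Under PULL-1 it is assumed that $B_j=1$ for all $j$. State. $S^n=(Q_i^n,D_i^n,\ i\in\mathcal{N})$, where $Q_i^n\in\mathbb{Z}_+$ is the queue length at server $i$, and $D^n_i\in\mathcal{R}$ is the router holding the pull-message of $i$ if $Q^n_i=0$, and $D^n_i=0$ if $Q_i^n>0$. The mean-field state is $s^n=(x^n,\xi^n)$, $x^n=(x^n_{k,j},k\in\mathbb{Z}_+,j\in\mathcal{J})$, $\xi^n=(\xi^n_{r,j},r\in\mathcal{R},j\in\mathcal{J})$, where $x^n_{k,j}$ is the fraction (out of all $n$ servers) of servers that are in pool $j$ and have queue length at least $k$, and $\xi^n_{r,j}$ is the fraction (out of all $n$) of servers that are idle, in pool $j$, and have their pull-message at router $r$. $s^n(\cdot)$ is a continuous-time irreducible Markov process on a countable state space; ergodic means positive recurrent (equivalently, having a unique stationary distribution). *)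

theory Defs
  imports "HOL-Probability.Probability"
begin

section \<open>Continuous-time Markov chains\<close>

text \<open>
  A time-homogeneous Markov chain on a countable state space \<open>E\<close> is a family of
  probability measures \<open>P i\<close> (the law when started in \<open>i \<in> E\<close>) together with a
  process \<open>X t\<close>, \<open>t \<ge> 0\<close>, whose paths are right-continuous for the discrete topology.
\<close>

definition trans_prob ::
  "('s \<Rightarrow> 'w measure) \<Rightarrow> (real \<Rightarrow> 'w \<Rightarrow> 's) \<Rightarrow> real \<Rightarrow> 's \<Rightarrow> 's \<Rightarrow> real" where
  "trans_prob P X t i j = measure (P i) {\<omega> \<in> space (P i). X t \<omega> = j}"

definition ctmc ::
  "'s set \<Rightarrow> ('s \<Rightarrow> 'w measure) \<Rightarrow> (real \<Rightarrow> 'w \<Rightarrow> 's) \<Rightarrow> bool" where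
  "ctmc E P X \<longleftrightarrow>
     countable E \<and>
     (\<forall>i\<in>E. prob_space (P i)) \<and>
     (\<forall>i\<in>E. \<forall>t\<ge>0. X t \<in> measurable (P i) (count_space E)) \<and>
     (\<forall>i\<in>E. \<forall>\<omega>\<in>space (P i). \<forall>t\<ge>0. \<exists>\<epsilon>>0. \<forall>s\<in>{t..<t + \<epsilon>}. X s \<omega> = X t \<omega>) \<and>
     (\<forall>i\<in>E. trans_prob P X 0 i i = 1) \<and>
     (\<forall>i\<in>E. \<forall>m (t :: nat \<Rightarrow> real) a.
        0 \<le> t 0 \<and> (\<forall>k\<le>m. t k < t (Suc k)) \<and> (\<forall>k\<le>Suc m. a k \<in> E) \<longrightarrow>
        measure (P i) {\<omega> \<in> space (P i). \<forall>k\<le>Suc m. X (t k) \<omega> = a k} =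
        measure (P i) {\<omega> \<in> space (P i). \<forall>k\<le>m. X (t k) \<omega> = a k} *
          trans_prob P X (t (Suc m) - t m) (a m) (a (Suc m)))"

text \<open>The values \<open>q i i\<close> are irrelevant here; only transitions between distinct states count.\<close>

definition ctmc_with_rates ::
  "'s set \<Rightarrow> ('s \<Rightarrow> 's \<Rightarrow> real) \<Rightarrow> ('s \<Rightarrow> 'w measure) \<Rightarrow> (real \<Rightarrow> 'w \<Rightarrow> 's) \<Rightarrow> bool" where
  "ctmc_with_rates E q P X \<longleftrightarrow>
     ctmc E P X \<and>
     (\<forall>i\<in>E. \<forall>j\<in>E. i \<noteq> j \<longrightarrow>
        ((\<lambda>h. trans_prob P X h i j / h) \<longlongrightarrow> q i j) (at_right 0)) \<and>
     (\<forall>i\<in>E. \<exists>c. (q i has_sum c) (E - {i}) \<and>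
        ((\<lambda>h. (1 - trans_prob P X h i i) / h) \<longlongrightarrow> c) (at_right 0))"

definition irreducible_chain ::
  "'s set \<Rightarrow> ('s \<Rightarrow> 'w measure) \<Rightarrow> (real \<Rightarrow> 'w \<Rightarrow> 's) \<Rightarrow> bool" where
  "irreducible_chain E P X \<longleftrightarrow> (\<forall>i\<in>E. \<forall>j\<in>E. \<exists>t\<ge>0. trans_prob P X t i j > 0)"

text \<open>First time at which the path is in \<open>i\<close> after having been outside \<open>i\<close>
  (\<open>\<infinity>\<close> if there is no such time).\<close>

definition return_time :: "(real \<Rightarrow> 'w \<Rightarrow> 's) \<Rightarrow> 's \<Rightarrow> 'w \<Rightarrow> ennreal" where
  "return_time X i \<omega> =
     (INF t\<in>{t. X t \<omega> = i \<and> (\<exists>s. 0 \<le> s \<and> s < t \<and> X s \<omega> \<noteq> i)}. ennreal t)"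

text \<open>Absorbing states do not get a special treatment: they have return time \<open>\<infinity>\<close> and hence
  do not count as positive recurrent. An irreducible chain with at least two states has none.\<close>

definition positive_recurrent ::
  "'s set \<Rightarrow> ('s \<Rightarrow> 'w measure) \<Rightarrow> (real \<Rightarrow> 'w \<Rightarrow> 's) \<Rightarrow> bool" where
  "positive_recurrent E P X \<longleftrightarrow>
     (\<forall>i\<in>E. (\<integral>\<^sup>+ \<omega>. return_time X i \<omega> \<partial>P i) < \<infinity>)"

definition ergodic_ctmc ::
  "'s set \<Rightarrow> ('s \<Rightarrow> 'w measure) \<Rightarrow> (real \<Rightarrow> 'w \<Rightarrow> 's) \<Rightarrow> bool" where
  "ergodic_ctmc E P X \<longleftrightarrow>
     ctmc E P X \<and> irreducible_chain E P X \<and> positive_recurrent E P X"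


section \<open>The PULL system\<close>

text \<open>
  Servers, pools and routers are the elements of finite types \<open>'i\<close>, \<open>'j\<close>, \<open>'r\<close>, so that
  \<open>n = CARD('i)\<close>, \<open>J = CARD('j)\<close>, \<open>R = CARD('r)\<close>; \<open>pool i\<close> is the pool of server \<open>i\<close>.
  A state is a pair \<open>(Q, D)\<close>: \<open>Q i\<close> is the queue length at \<open>i\<close>, and \<open>D i = Some r\<close> if the
  pull-message of \<open>i\<close> is at router \<open>r\<close>, \<open>D i = None\<close> if \<open>i\<close> is busy.
\<close>

datatype pull_version = PULL1 | PULL2

type_synonym ('i, 'r) pull_state = "('i \<Rightarrow> nat) \<times> ('i \<Rightarrow> 'r option)"

definition pull_states :: "('j \<Rightarrow> enat) \<Rightarrow> ('i \<Rightarrow> 'j) \<Rightarrow> ('i, 'r) pull_state set" where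
  "pull_states B pool =
     {(Q, D). \<forall>i. enat (Q i) \<le> B (pool i) \<and> (D i = None \<longleftrightarrow> Q i > 0)}"

text \<open>
  Rate of jumping from \<open>(Q, D)\<close> to \<open>S'\<close> by a service completion. A server that becomes idle
  places its pull-message at a uniformly chosen router.
\<close>

definition service_rate ::
  "('j \<Rightarrow> real) \<Rightarrow> ('i::finite \<Rightarrow> 'j) \<Rightarrow>
     ('i, 'r::finite) pull_state \<Rightarrow> ('i, 'r) pull_state \<Rightarrow> real" where
  "service_rate \<mu> pool = (\<lambda>(Q, D) S'.
     \<Sum>i\<in>UNIV.
       if Q i = 0 then 0
       else if Q i = 1 then
         (\<Sum>r\<in>UNIV. \<mu> (pool i) / real CARD('r) * of_bool (S' = (Q(i := 0), D(i := Some r))))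
       else \<mu> (pool i) * of_bool (S' = (Q(i := Q i - 1), D)))"

text \<open>
  Rate of jumping from \<open>(Q, D)\<close> to \<open>S'\<close> by an arrival, for total arrival rate \<open>\<Lambda>\<close>.
  The set \<open>{i. D i = Some r}\<close> consists of the idle servers whose pull-message is at \<open>r\<close>.
  Under \<open>PULL2\<close>, a customer may be routed at random to an idle server whose pull-message is at
  another router; that message is then destroyed too. Blocked customers cause no jump.
\<close>

definition arrival_rate ::
  "pull_version \<Rightarrow> real \<Rightarrow> ('j \<Rightarrow> enat) \<Rightarrow> ('i::finite \<Rightarrow> 'j) \<Rightarrow>
     ('i, 'r::finite) pull_state \<Rightarrow> ('i, 'r) pull_state \<Rightarrow> real" where
  "arrival_rate ver \<Lambda> B pool = (\<lambda>(Q, D) S'.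
     \<Sum>r\<in>UNIV.
       if {i. D i = Some r} \<noteq> {} then
         (\<Sum>i\<in>{i. D i = Some r}. \<Lambda> / real CARD('r) / real (card {i. D i = Some r}) *
            of_bool (S' = (Q(i := 1), D(i := None))))
       else
         (case ver of
            PULL1 \<Rightarrow> 0
          | PULL2 \<Rightarrow>
              (\<Sum>i\<in>UNIV. \<Lambda> / real CARD('r) / real CARD('i) *
                 of_bool (enat (Q i) < B (pool i) \<and>
                          S' = (Q(i := Q i + 1), D(i := None))))))"

definition pull_rate ::
  "pull_version \<Rightarrow> real \<Rightarrow> ('j \<Rightarrow> real) \<Rightarrow> ('j \<Rightarrow> enat) \<Rightarrow> ('i::finite \<Rightarrow> 'j) \<Rightarrow>
     ('i, 'r::finite) pull_state \<Rightarrow> ('i, 'r) pull_state \<Rightarrow> real" where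
  "pull_rate ver lam \<mu> B pool S S' =
     service_rate \<mu> pool S S' + arrival_rate ver (lam * real CARD('i)) B pool S S'"

text \<open>The mean-field state \<open>(x, \<xi>)\<close> with \<open>x k j\<close> and \<open>\<xi> r j\<close>.\<close>

definition mean_field ::
  "('i::finite \<Rightarrow> 'j) \<Rightarrow> ('i, 'r) pull_state \<Rightarrow> (nat \<Rightarrow> 'j \<Rightarrow> real) \<times> ('r \<Rightarrow> 'j \<Rightarrow> real)" where
  "mean_field pool = (\<lambda>(Q, D).
     (\<lambda>k j. real (card {i. pool i = j \<and> Q i \<ge> k}) / real CARD('i),
      \<lambda>r j. real (card {i. pool i = j \<and> Q i = 0 \<and> D i = Some r}) / real CARD('i)))"

definition mean_field_states ::
  "('j \<Rightarrow> enat) \<Rightarrow> ('i::finite \<Rightarrow> 'j) \<Rightarrow> 'r itself \<Rightarrow>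
     ((nat \<Rightarrow> 'j \<Rightarrow> real) \<times> ('r \<Rightarrow> 'j \<Rightarrow> real)) set" where
  "mean_field_states B pool _ = mean_field pool ` (pull_states B pool :: ('i, 'r) pull_state set)"

text \<open>
  The process \<open>mean_field pool (S t)\<close> started in \<open>v\<close> is obtained by starting \<open>S\<close> in some state
  with mean-field value \<open>v\<close>; a start selection picks one such state for every \<open>v\<close>.
\<close>

definition start_selection ::
  "('j \<Rightarrow> enat) \<Rightarrow> ('i::finite \<Rightarrow> 'j) \<Rightarrow>
     ((nat \<Rightarrow> 'j \<Rightarrow> real) \<times> ('r \<Rightarrow> 'j \<Rightarrow> real) \<Rightarrow> ('i, 'r) pull_state) \<Rightarrow> bool" where
  "start_selection B pool st \<longleftrightarrow>
     (\<forall>v\<in>mean_field_states B pool TYPE('r). st v \<in> pull_states B pool \<and> mean_field pool (st v) = v)"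

end

theory Submission
  imports Defs "HOL-Combinatorics.Permutations"
begin

text \<open>
  Since all buffers are finite, so is the state space. Two states with the same mean-field value
  differ by a permutation of the servers that preserves the pools, and the rates are invariant
  under such permutations. The rates determine the transition probabilities, which are therefore
  invariant too, and the mean-field process is a lumping of the server-level chain, hence a
  Markov chain on a finite set. From any state one can reach the state with all queues of length
  \<open>1\<close>, and from there any other state, so the chain is irreducible. Thus for some \<open>T\<close> all
  transition probabilities over time \<open>T\<close> are bounded below by a \<open>\<delta> > 0\<close>, and return times have
  geometric tails.
\<close>

section \<open>Finite Markov chains in continuous time\<close>

text \<open>\<open>ctmc\<close> gives the Markov property only at finitely many fixed times, and
  \<open>ctmc_with_rates\<close> only limits as \<open>h\<close> tends to 0; neither a jump chain
  nor the strong Markov property is at hand. Everything is therefore derived from finite path sums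
  and the Chapman-Kolmogorov equation: the passage from rates to transition probabilities compares
  two semigroups directly instead of solving Kolmogorov's equations, and returns are observed only
  at multiples of \<open>T\<close>. A common \<open>T\<close> exists because there is no periodicity
  in continuous time: \<open>p t i i\<close> is positive for every \<open>t\<close>, so time left
  over after reaching a state can be spent there. Recurrence is proved for the lumped chain itself,
  because its return times refer to its own excursions: leaving a server-level state need not change
  the mean-field value.\<close>

lemma increasing_nonneg:
  fixes t :: "nat \<Rightarrow> real"
  assumes "0 \<le> t 0" "\<And>k. k \<le> m \<Longrightarrow> t k < t (Suc k)" "k \<le> Suc m"
  shows "0 \<le> t k"
  using assms(3)
proof (induction k)
  case (Suc k)
  then have "0 \<le> t k" "t k < t (Suc k)" using assms(2)[of k] by auto
  then show ?case by simp
qed (rule assms(1))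

locale finite_ctmc =
  fixes E :: "'s set" and P :: "'s \<Rightarrow> 'w measure" and X :: "real \<Rightarrow> 'w \<Rightarrow> 's"
  assumes ctmc: "ctmc E P X" and finite_E: "finite E"
begin

abbreviation p :: "real \<Rightarrow> 's \<Rightarrow> 's \<Rightarrow> real" where
  "p \<equiv> trans_prob P X"

lemma prob_space_P: "i \<in> E \<Longrightarrow> prob_space (P i)"
  using ctmc by (simp add: ctmc_def)

lemma measurable_X: "i \<in> E \<Longrightarrow> 0 \<le> t \<Longrightarrow> X t \<in> measurable (P i) (count_space E)"
  using ctmc by (simp add: ctmc_def)

lemma X_in_E: "i \<in> E \<Longrightarrow> 0 \<le> t \<Longrightarrow> \<omega> \<in> space (P i) \<Longrightarrow> X t \<omega> \<in> E"
  using measurable_space[OF measurable_X] by auto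

lemma sets_X:
  assumes "i \<in> E" "0 \<le> t"
  shows "{\<omega> \<in> space (P i). \<Phi> (X t \<omega>)} \<in> sets (P i)"
proof -
  have "Measurable.pred (P i) (\<lambda>\<omega>. \<Phi> (X t \<omega>))"
    by (rule measurable_compose[OF measurable_X[OF assms]]) auto
  then show ?thesis by simp
qed

lemma sets_cylinder:
  fixes m :: nat
  assumes "i \<in> E" "\<And>k. k \<le> m \<Longrightarrow> 0 \<le> t k"
  shows "{\<omega> \<in> space (P i). \<forall>k\<le>m. X (t k) \<omega> = a k} \<in> sets (P i)"
proof -
  have "{\<omega> \<in> space (P i). \<forall>k\<in>{..m}. X (t k) \<omega> = a k} \<in> sets (P i)"
    by (rule sets.sets_Collect_countable_All') (use sets_X assms in auto)
  then show ?thesis by (simp only: Ball_def atMost_iff)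
qed

lemma markov:
  assumes "i \<in> E" "0 \<le> t 0" "\<And>k. k \<le> m \<Longrightarrow> t k < t (Suc k)" "\<And>k. k \<le> Suc m \<Longrightarrow> a k \<in> E"
  shows "measure (P i) {\<omega> \<in> space (P i). \<forall>k\<le>Suc m. X (t k) \<omega> = a k} =
    measure (P i) {\<omega> \<in> space (P i). \<forall>k\<le>m. X (t k) \<omega> = a k} * p (t (Suc m) - t m) (a m) (a (Suc m))"
proof -
  have "\<forall>i\<in>E. \<forall>m (t :: nat \<Rightarrow> real) a.
      0 \<le> t 0 \<and> (\<forall>k\<le>m. t k < t (Suc k)) \<and> (\<forall>k\<le>Suc m. a k \<in> E) \<longrightarrow>
      measure (P i) {\<omega> \<in> space (P i). \<forall>k\<le>Suc m. X (t k) \<omega> = a k} =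
      measure (P i) {\<omega> \<in> space (P i). \<forall>k\<le>m. X (t k) \<omega> = a k} * p (t (Suc m) - t m) (a m) (a (Suc m))"
    using ctmc unfolding ctmc_def by (elim conjE)
  from this[rule_format, of i t m a] show ?thesis using assms by blast
qed

lemma trans_prob_nonneg: "0 \<le> p t i j"
  by (simp add: trans_prob_def)

lemma prob_eq_sum_trans_prob:
  assumes "i \<in> E" "0 \<le> t"
  shows "measure (P i) {\<omega> \<in> space (P i). \<Phi> (X t \<omega>)} = (\<Sum>j\<in>{j\<in>E. \<Phi> j}. p t i j)"
proof -
  interpret prob_space "P i" by (rule prob_space_P[OF assms(1)])
  have "{\<omega> \<in> space (P i). \<Phi> (X t \<omega>)} = (\<Union>j\<in>{j\<in>E. \<Phi> j}. {\<omega> \<in> space (P i). X t \<omega> = j})"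
    using X_in_E assms by auto
  also have "measure (P i) \<dots> = (\<Sum>j\<in>{j\<in>E. \<Phi> j}. p t i j)"
    unfolding trans_prob_def
    by (rule finite_measure_finite_Union) (use finite_E sets_X assms in \<open>auto simp: disjoint_family_on_def\<close>)
  finally show ?thesis .
qed

lemma sum_trans_prob: "i \<in> E \<Longrightarrow> 0 \<le> t \<Longrightarrow> (\<Sum>j\<in>E. p t i j) = 1"
  using prob_eq_sum_trans_prob[of i t "\<lambda>_. True"] prob_space.prob_space[OF prob_space_P] by simp

text \<open>\<open>p 0 i i = 1\<close> leaves no mass for the other entries of a row that sums to
  1.\<close>

lemma trans_prob_0:
  assumes "i \<in> E" "j \<in> E"
  shows "p 0 i j = of_bool (i = j)"
proof -
  have i: "p 0 i i = 1" using ctmc assms by (simp add: ctmc_def)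
  have "(\<Sum>j\<in>E - {i}. p 0 i j) = 0"
    using sum_trans_prob[of i 0] i assms finite_E by (simp add: sum.remove)
  then have "\<forall>j\<in>E - {i}. p 0 i j = 0"
    using finite_E by (subst (asm) sum_nonneg_eq_0_iff) (auto simp: trans_prob_nonneg)
  then show ?thesis using i assms by auto
qed

text \<open>This is \<open>markov\<close> at the two times \<open>s\<close> and
  \<open>s + t\<close>, summed over the state at time \<open>s\<close>. Its times must increase
  strictly, so \<open>t = 0\<close> is treated apart.\<close>

lemma Chapman_Kolmogorov:
  assumes "i \<in> E" "j \<in> E" "0 \<le> s" "0 \<le> t"
  shows "p (s + t) i j = (\<Sum>k\<in>E. p s i k * p t k j)"
proof (cases "t = 0")
  case True
  have "(\<Sum>k\<in>E. p s i k * p 0 k j) = (\<Sum>k\<in>E. if k = j then p s i k else 0)"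
    using assms by (intro sum.cong) (auto simp: trans_prob_0)
  then show ?thesis using True assms finite_E by simp
next
  case False
  interpret prob_space "P i" by (rule prob_space_P[OF assms(1)])
  \<comment> \<open>Only the values at 0 and \<open>Suc 0\<close> matter: the times are
    \<open>s\<close> and \<open>s + t\<close>, the states \<open>k\<close> and
    \<open>j\<close>.\<close>
  let ?t = "\<lambda>n. s + real n * t"
  let ?a = "\<lambda>k n. if n = 0 then k else j"
  have le1: "(\<forall>n\<le>Suc 0. \<phi> n) \<longleftrightarrow> \<phi> 0 \<and> \<phi> (Suc 0)" for \<phi>
    by (metis le_Suc_eq le_zero_eq)
  have "p (s + t) i j = measure (P i) (\<Union>k\<in>E. {\<omega> \<in> space (P i). \<forall>n\<le>Suc 0. X (?t n) \<omega> = ?a k n})"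
    unfolding trans_prob_def using X_in_E assms
    by (intro arg_cong[where f = "measure (P i)"]) (auto simp: le1)
  also have "\<dots> = (\<Sum>k\<in>E. measure (P i) {\<omega> \<in> space (P i). \<forall>n\<le>Suc 0. X (?t n) \<omega> = ?a k n})"
  proof (rule finite_measure_finite_Union)
    show "(\<lambda>k. {\<omega> \<in> space (P i). \<forall>n\<le>Suc 0. X (?t n) \<omega> = ?a k n}) ` E \<subseteq> sets (P i)"
      by (rule image_subsetI, rule sets_cylinder) (use assms in auto)
    show "disjoint_family_on (\<lambda>k. {\<omega> \<in> space (P i). \<forall>n\<le>Suc 0. X (?t n) \<omega> = ?a k n}) E"
      unfolding disjoint_family_on_def le1 by auto
  qed (rule finite_E)
  also have "\<dots> = (\<Sum>k\<in>E. p s i k * p t k j)"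
  proof (rule sum.cong[OF refl])
    fix k assume "k \<in> E"
    then show "measure (P i) {\<omega> \<in> space (P i). \<forall>n\<le>Suc 0. X (?t n) \<omega> = ?a k n} = p s i k * p t k j"
      using assms False markov[of i ?t 0 "?a k"] by (simp add: trans_prob_def)
  qed
  finally show ?thesis .
qed

section \<open>Events determined by finitely many times\<close>

text \<open>The condition on \<open>\<Phi>\<close> says that only the first \<open>m + 1\<close>
  values count, so the event is a finite disjoint union of cylinders. Extensional functions
  represent each finite path exactly once.\<close>

lemma prob_eq_sum_paths:
  fixes m :: nat
  assumes "i \<in> E" "\<And>k. k \<le> m \<Longrightarrow> 0 \<le> t k"
    and \<Phi>: "\<And>f g. (\<And>k. k \<le> m \<Longrightarrow> f k = g k) \<Longrightarrow> \<Phi> f = \<Phi> g"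
  shows "measure (P i) {\<omega> \<in> space (P i). \<Phi> (\<lambda>k. X (t k) \<omega>)} =
    (\<Sum>b\<in>{b \<in> {..m} \<rightarrow>\<^sub>E E. \<Phi> b}. measure (P i) {\<omega> \<in> space (P i). \<forall>k\<le>m. X (t k) \<omega> = b k})"
proof -
  interpret prob_space "P i" by (rule prob_space_P[OF assms(1)])
  let ?B = "{b \<in> {..m} \<rightarrow>\<^sub>E E. \<Phi> b}"
  have "{\<omega> \<in> space (P i). \<Phi> (\<lambda>k. X (t k) \<omega>)} = (\<Union>b\<in>?B. {\<omega> \<in> space (P i). \<forall>k\<le>m. X (t k) \<omega> = b k})"
  proof (intro equalityI subsetI)
    fix \<omega> assume \<omega>: "\<omega> \<in> {\<omega> \<in> space (P i). \<Phi> (\<lambda>k. X (t k) \<omega>)}"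
    let ?b = "restrict (\<lambda>k. X (t k) \<omega>) {..m}"
    have "\<Phi> ?b = \<Phi> (\<lambda>k. X (t k) \<omega>)" by (rule \<Phi>) simp
    then have "?b \<in> ?B" using \<omega> X_in_E assms(1,2) by auto
    then show "\<omega> \<in> (\<Union>b\<in>?B. {\<omega> \<in> space (P i). \<forall>k\<le>m. X (t k) \<omega> = b k})"
      using \<omega> by (intro UN_I[of ?b]) auto
  next
    fix \<omega> assume "\<omega> \<in> (\<Union>b\<in>?B. {\<omega> \<in> space (P i). \<forall>k\<le>m. X (t k) \<omega> = b k})"
    then obtain b where b: "b \<in> ?B" "\<omega> \<in> space (P i)" "\<forall>k\<le>m. X (t k) \<omega> = b k" by auto
    then have "\<Phi> (\<lambda>k. X (t k) \<omega>) = \<Phi> b" by (intro \<Phi>) auto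
    then show "\<omega> \<in> {\<omega> \<in> space (P i). \<Phi> (\<lambda>k. X (t k) \<omega>)}" using b by auto
  qed
  also have "measure (P i) \<dots> = (\<Sum>b\<in>?B. measure (P i) {\<omega> \<in> space (P i). \<forall>k\<le>m. X (t k) \<omega> = b k})"
  proof (rule finite_measure_finite_Union)
    show "finite ?B" using finite_PiE[of "{..m}" "\<lambda>_. E"] finite_E by (auto intro: finite_subset)
    show "(\<lambda>b. {\<omega> \<in> space (P i). \<forall>k\<le>m. X (t k) \<omega> = b k}) ` ?B \<subseteq> sets (P i)"
      by (rule image_subsetI, rule sets_cylinder) (use assms(1,2) in blast)+
    show "disjoint_family_on (\<lambda>b. {\<omega> \<in> space (P i). \<forall>k\<le>m. X (t k) \<omega> = b k}) ?B"
      unfolding disjoint_family_on_def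
    proof (intro ballI impI)
      fix b c assume "b \<in> ?B" "c \<in> ?B" "b \<noteq> c"
      then obtain k where k: "k \<le> m" "b k \<noteq> c k" using PiE_ext[of b "{..m}" "\<lambda>_. E" c] by auto
      show "{\<omega> \<in> space (P i). \<forall>k\<le>m. X (t k) \<omega> = b k} \<inter> {\<omega> \<in> space (P i). \<forall>k\<le>m. X (t k) \<omega> = c k} = {}"
        using k by (intro equals0I) (auto dest!: spec[of _ k])
    qed
  qed
  finally show ?thesis .
qed

text \<open>The Markov property for events instead of single states: once the past is split into
  full paths, only the end point \<open>b m\<close> enters the last factor.\<close>

lemma prob_extend_paths:
  assumes i: "i \<in> E" and t0: "0 \<le> t 0" and t: "\<And>k. k \<le> m \<Longrightarrow> t k < t (Suc k)"
    and \<Phi>: "\<And>f g. (\<And>k. k \<le> m \<Longrightarrow> f k = g k) \<Longrightarrow> \<Phi> f = \<Phi> g"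
  shows "measure (P i) {\<omega> \<in> space (P i). \<Phi> (\<lambda>k. X (t k) \<omega>) \<and> \<psi> (X (t (Suc m)) \<omega>)} =
    (\<Sum>b\<in>{b \<in> {..m} \<rightarrow>\<^sub>E E. \<Phi> b}. measure (P i) {\<omega> \<in> space (P i). \<forall>k\<le>m. X (t k) \<omega> = b k} *
       (\<Sum>c\<in>{c\<in>E. \<psi> c}. p (t (Suc m) - t m) (b m) c))"
proof -
  have tn: "0 \<le> t k" if "k \<le> Suc m" for k
    by (rule increasing_nonneg[OF t0 t that])
  let ?C = "{c\<in>E. \<psi> c}" and ?B = "{b \<in> {..m} \<rightarrow>\<^sub>E E. \<Phi> b}"
  have "measure (P i) {\<omega> \<in> space (P i). \<Phi> (\<lambda>k. X (t k) \<omega>) \<and> \<psi> (X (t (Suc m)) \<omega>)} =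
    (\<Sum>b\<in>{b \<in> {..Suc m} \<rightarrow>\<^sub>E E. \<Phi> b \<and> \<psi> (b (Suc m))}.
       measure (P i) {\<omega> \<in> space (P i). \<forall>k\<le>Suc m. X (t k) \<omega> = b k})"
  proof (rule prob_eq_sum_paths[of i "Suc m" t "\<lambda>b. \<Phi> b \<and> \<psi> (b (Suc m))"])
    fix f g :: "nat \<Rightarrow> 's" assume fg: "\<And>k. k \<le> Suc m \<Longrightarrow> f k = g k"
    then have "\<Phi> f = \<Phi> g" by (intro \<Phi>) auto
    then show "(\<Phi> f \<and> \<psi> (f (Suc m))) = (\<Phi> g \<and> \<psi> (g (Suc m)))" using fg by simp
  qed (use i tn in auto)
  also have "\<dots> = (\<Sum>(b, c)\<in>?B \<times> ?C. measure (P i) {\<omega> \<in> space (P i). \<forall>k\<le>m. X (t k) \<omega> = b k} *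
       p (t (Suc m) - t m) (b m) c)"
  \<comment> \<open>A path is cut into its first \<open>m + 1\<close> states and its last one;
    \<open>restrict\<close> makes the first piece extensional again.\<close>
  proof (rule sum.reindex_bij_witness[of _ "\<lambda>(b, c). b(Suc m := c)" "\<lambda>b. (restrict b {..m}, b (Suc m))"])
    fix b assume "b \<in> {b \<in> {..Suc m} \<rightarrow>\<^sub>E E. \<Phi> b \<and> \<psi> (b (Suc m))}"
    then have b: "b \<in> {..Suc m} \<rightarrow>\<^sub>E E" "\<Phi> b" "\<psi> (b (Suc m))" by auto
    have "\<Phi> (restrict b {..m}) = \<Phi> b" by (rule \<Phi>) simp
    then show "(restrict b {..m}, b (Suc m)) \<in> ?B \<times> ?C" using b by (auto simp: PiE_iff)
    show "(case (restrict b {..m}, b (Suc m)) of (b, c) \<Rightarrow> b(Suc m := c)) = b"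
      using b by (auto simp: fun_eq_iff PiE_iff extensional_def)
    show "(case (restrict b {..m}, b (Suc m)) of (b, c) \<Rightarrow>
        measure (P i) {\<omega> \<in> space (P i). \<forall>k\<le>m. X (t k) \<omega> = b k} * p (t (Suc m) - t m) (b m) c) =
      measure (P i) {\<omega> \<in> space (P i). \<forall>k\<le>Suc m. X (t k) \<omega> = b k}"
      using b i t0 t by (subst markov) (auto simp: PiE_iff)
  next
    fix bc assume "bc \<in> ?B \<times> ?C"
    then obtain b c where bc: "bc = (b, c)" "b \<in> {..m} \<rightarrow>\<^sub>E E" "\<Phi> b" "c \<in> E" "\<psi> c" by auto
    have "\<Phi> (b(Suc m := c)) = \<Phi> b" by (rule \<Phi>) simp
    then show "(case bc of (b, c) \<Rightarrow> b(Suc m := c)) \<in> {b \<in> {..Suc m} \<rightarrow>\<^sub>E E. \<Phi> b \<and> \<psi> (b (Suc m))}"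
      using bc by (auto simp: PiE_iff extensional_def)
    show "(restrict (case bc of (b, c) \<Rightarrow> b(Suc m := c)) {..m}, (case bc of (b, c) \<Rightarrow> b(Suc m := c)) (Suc m)) = bc"
      using bc by (auto simp: fun_eq_iff PiE_iff extensional_def)
  qed
  also have "\<dots> = (\<Sum>b\<in>?B. measure (P i) {\<omega> \<in> space (P i). \<forall>k\<le>m. X (t k) \<omega> = b k} *
       (\<Sum>c\<in>?C. p (t (Suc m) - t m) (b m) c))"
    by (simp add: sum.cartesian_product[symmetric] sum_distrib_left)
  finally show ?thesis .
qed

text \<open>Whatever the past, the next observation hits \<open>c\<close> with conditional
  probability at least \<open>\<delta>\<close>; summing over the past paths keeps the bound.\<close>

lemma prob_extend_paths_ge:
  assumes "i \<in> E" "0 \<le> t 0" "\<And>k. k \<le> m \<Longrightarrow> t k < t (Suc k)"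
    and "\<And>f g. (\<And>k. k \<le> m \<Longrightarrow> f k = g k) \<Longrightarrow> \<Phi> f = \<Phi> g"
    and c: "c \<in> E" and \<delta>: "\<And>k. k \<in> E \<Longrightarrow> \<delta> \<le> p (t (Suc m) - t m) k c"
  shows "\<delta> * measure (P i) {\<omega> \<in> space (P i). \<Phi> (\<lambda>k. X (t k) \<omega>)} \<le>
    measure (P i) {\<omega> \<in> space (P i). \<Phi> (\<lambda>k. X (t k) \<omega>) \<and> X (t (Suc m)) \<omega> = c}"
proof -
  have tn: "0 \<le> t k" if "k \<le> m" for k
    by (rule increasing_nonneg[of t m]) (use assms(2,3) that le_SucI in blast)+
  let ?B = "{b \<in> {..m} \<rightarrow>\<^sub>E E. \<Phi> b}"
  let ?c = "\<lambda>b. measure (P i) {\<omega> \<in> space (P i). \<forall>k\<le>m. X (t k) \<omega> = b k}"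
  have "\<delta> * measure (P i) {\<omega> \<in> space (P i). \<Phi> (\<lambda>k. X (t k) \<omega>)} = (\<Sum>b\<in>?B. ?c b * \<delta>)"
  proof -
    have "measure (P i) {\<omega> \<in> space (P i). \<Phi> (\<lambda>k. X (t k) \<omega>)} = (\<Sum>b\<in>?B. ?c b)"
      by (rule prob_eq_sum_paths) (fact assms(1) tn assms(4))+
    then show ?thesis by (simp only: sum_distrib_left mult.commute)
  qed
  also have "\<dots> \<le> (\<Sum>b\<in>?B. ?c b * (\<Sum>c'\<in>{c' \<in> E. c' = c}. p (t (Suc m) - t m) (b m) c'))"
  proof (intro sum_mono mult_left_mono)
    fix b assume "b \<in> ?B"
    then have "b m \<in> E" by auto
    moreover have "{c' \<in> E. c' = c} = {c}" using c by auto
    ultimately show "\<delta> \<le> (\<Sum>c'\<in>{c' \<in> E. c' = c}. p (t (Suc m) - t m) (b m) c')"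
      using \<delta> by simp
  qed simp
  also have "\<dots> = measure (P i) {\<omega> \<in> space (P i). \<Phi> (\<lambda>k. X (t k) \<omega>) \<and> X (t (Suc m)) \<omega> = c}"
    by (rule prob_extend_paths[of i t m \<Phi> "\<lambda>c'. c' = c", symmetric]) (fact assms(1-4))+
  finally show ?thesis .
qed

section \<open>Positivity and symmetry of the transition probabilities\<close>

lemma trans_prob_add_ge:
  assumes "i \<in> E" "j \<in> E" "k \<in> E" "0 \<le> s" "0 \<le> t"
  shows "p s i k * p t k j \<le> p (s + t) i j"
  unfolding Chapman_Kolmogorov[OF assms(1,2,4,5)]
  using assms finite_E by (intro member_le_sum) (auto simp: trans_prob_nonneg)

text \<open>\<open>t\<close> is cut into \<open>n\<close> pieces shorter than
  \<open>\<epsilon>\<close>; being at \<open>i\<close> after each piece already has positive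
  probability.\<close>

lemma trans_prob_self_pos:
  assumes i: "i \<in> E" and lim: "((\<lambda>h. p h i i) \<longlongrightarrow> 1) (at_right 0)" and t: "0 \<le> t"
  shows "0 < p t i i"
proof (cases "t = 0")
  case True
  then show ?thesis using i by (simp add: trans_prob_0)
next
  case False
  have "eventually (\<lambda>h. 0 < p h i i) (at_right 0)"
    using order_tendstoD(1)[OF lim, of 0] by simp
  then obtain \<epsilon> where \<epsilon>: "\<epsilon> > 0" "\<And>h. 0 < h \<Longrightarrow> h < \<epsilon> \<Longrightarrow> 0 < p h i i"
    by (auto simp: eventually_at_right_field)
  obtain n where n: "t / \<epsilon> < real n" using reals_Archimedean2 by blast
  then have n0: "0 < real n" using t \<epsilon> by (smt (verit) divide_nonneg_pos)
  have h: "0 < p (t / n) i i"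
    using \<epsilon> n n0 t False by (intro \<epsilon>(2)) (auto simp: field_simps)
  have "0 < p (real k * (t / n)) i i" for k
  proof (induction k)
    case 0
    then show ?case using i by (simp add: trans_prob_0)
  next
    case (Suc k)
    then have "0 < p (real k * (t / n)) i i * p (t / n) i i" using h by simp
    also have "\<dots> \<le> p (real k * (t / n) + t / n) i i"
      using i t by (intro trans_prob_add_ge) auto
    finally show ?case by (simp add: algebra_simps add_divide_distrib)
  qed
  from this[of n] show ?thesis using n0 by simp
qed

text \<open>Two stochastic semigroups with the same generator satisfy
  \<open>\<bar>p\<^sub>t - p'\<^sub>t\<bar> \<le> n * \<bar>p\<^sub>h - p'\<^sub>h\<bar>\<close> for \<open>h = t / n\<close>, which tends to \<open>0\<close> since \<open>\<bar>p\<^sub>h - p'\<^sub>h\<bar> = o(h)\<close>.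
  Here \<open>p'\<close> is the conjugate of \<open>p\<close> by the symmetry \<open>\<sigma>\<close>.\<close>

lemma trans_prob_symmetric:
  assumes \<sigma>: "bij_betw \<sigma> E E"
    and lim: "\<And>i j. i \<in> E \<Longrightarrow> j \<in> E \<Longrightarrow> i \<noteq> j \<Longrightarrow> ((\<lambda>h. p h i j / h) \<longlongrightarrow> q i j) (at_right 0)"
    and q: "\<And>i j. i \<in> E \<Longrightarrow> j \<in> E \<Longrightarrow> q (\<sigma> i) (\<sigma> j) = q i j"
    and i: "i \<in> E" and j: "j \<in> E" and t: "0 \<le> t"
  shows "p t (\<sigma> i) (\<sigma> j) = p t i j"
proof -
  have \<sigma>E: "\<sigma> k \<in> E" if "k \<in> E" for k using \<sigma> that by (auto simp: bij_betw_def)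
  have \<sigma>inj: "\<sigma> k = \<sigma> l \<longleftrightarrow> k = l" if "k \<in> E" "l \<in> E" for k l
    using \<sigma> that by (auto simp: bij_betw_def inj_on_def)
  define d where "d h i j = \<bar>p h (\<sigma> i) (\<sigma> j) - p h i j\<bar>" for h i j
  \<comment> \<open>The sum over all rows bounds the one-step error of every row, so
    \<open>step\<close> can use the same \<open>D h\<close> for all \<open>i\<close>.\<close>
  define D where "D h = (\<Sum>i\<in>E. \<Sum>j\<in>E. d h i j)" for h
  have sum\<sigma>: "(\<Sum>k\<in>E. p h i (\<sigma> k)) = 1" if "i \<in> E" "0 \<le> h" for i h
    using sum.reindex_bij_betw[OF \<sigma>, of "p h i"] sum_trans_prob that by simp
  have step: "(\<Sum>j\<in>E. d (real n * h) i j) \<le> real n * D h" if "i \<in> E" "0 \<le> h" for n h i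
    using that(1)
  proof (induction n arbitrary: i)
    case 0
    then show ?case using \<sigma>E \<sigma>inj by (auto simp: d_def trans_prob_0)
  next
    case (Suc n)
    have "d (real (Suc n) * h) i j \<le>
        (\<Sum>k\<in>E. d h i k * p (real n * h) (\<sigma> k) (\<sigma> j)) + (\<Sum>k\<in>E. p h i k * d (real n * h) k j)"
      if "j \<in> E" for j
    proof -
      have *: "p (real (Suc n) * h) i j = (\<Sum>k\<in>E. p h i k * p (real n * h) k j)" if "i \<in> E" "j \<in> E" for i j
        using Chapman_Kolmogorov[of i j h "real n * h"] that \<open>0 \<le> h\<close> by (simp add: algebra_simps)
      have "p (real (Suc n) * h) (\<sigma> i) (\<sigma> j) - p (real (Suc n) * h) i j =
          (\<Sum>k\<in>E. p h (\<sigma> i) (\<sigma> k) * p (real n * h) (\<sigma> k) (\<sigma> j)) - (\<Sum>k\<in>E. p h i k * p (real n * h) k j)"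
        using *[of "\<sigma> i" "\<sigma> j"] *[of i j] \<sigma>E Suc.prems that
          sum.reindex_bij_betw[OF \<sigma>, of "\<lambda>k. p h (\<sigma> i) k * p (real n * h) k (\<sigma> j)"] by simp
      \<comment> \<open>\<open>p h i k * p (real n * h) (\<sigma> k) (\<sigma> j)\<close> is
        subtracted and added: the first sum carries the error of the first step, the second that of
        the remaining \<open>n\<close> steps.\<close>
      also have "\<dots> = (\<Sum>k\<in>E. (p h (\<sigma> i) (\<sigma> k) - p h i k) * p (real n * h) (\<sigma> k) (\<sigma> j)) +
          (\<Sum>k\<in>E. p h i k * (p (real n * h) (\<sigma> k) (\<sigma> j) - p (real n * h) k j))"
        by (simp add: sum_subtractf[symmetric] sum.distrib[symmetric] algebra_simps)
      finally have "d (real (Suc n) * h) i j \<le>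
          \<bar>\<Sum>k\<in>E. (p h (\<sigma> i) (\<sigma> k) - p h i k) * p (real n * h) (\<sigma> k) (\<sigma> j)\<bar> +
          \<bar>\<Sum>k\<in>E. p h i k * (p (real n * h) (\<sigma> k) (\<sigma> j) - p (real n * h) k j)\<bar>"
        unfolding d_def by linarith
      also have "\<dots> \<le> (\<Sum>k\<in>E. d h i k * p (real n * h) (\<sigma> k) (\<sigma> j)) + (\<Sum>k\<in>E. p h i k * d (real n * h) k j)"
        unfolding d_def
        by (intro add_mono order.trans[OF sum_abs] sum_mono) (auto simp: abs_mult trans_prob_nonneg)
      finally show ?thesis .
    qed
    then have "(\<Sum>j\<in>E. d (real (Suc n) * h) i j) \<le>
        (\<Sum>j\<in>E. (\<Sum>k\<in>E. d h i k * p (real n * h) (\<sigma> k) (\<sigma> j)) + (\<Sum>k\<in>E. p h i k * d (real n * h) k j))"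
      by (rule sum_mono)
    \<comment> \<open>After the exchange the inner sum of transition probabilities is 1, so errors
      add up and are not amplified.\<close>
    also have "\<dots> = (\<Sum>k\<in>E. d h i k * (\<Sum>j\<in>E. p (real n * h) (\<sigma> k) (\<sigma> j))) +
        (\<Sum>k\<in>E. p h i k * (\<Sum>j\<in>E. d (real n * h) k j))"
      unfolding sum.distrib sum_distrib_left by (intro arg_cong2[where f = plus] sum.swap)
    also have "\<dots> \<le> (\<Sum>k\<in>E. d h i k) + (\<Sum>k\<in>E. p h i k * (real n * D h))"
      using sum\<sigma> \<sigma>E Suc \<open>0 \<le> h\<close>
      by (intro add_mono sum_mono mult_left_mono) (auto simp: trans_prob_nonneg)
    also have "(\<Sum>k\<in>E. p h i k * (real n * D h)) = real n * D h"
      using sum_trans_prob[OF Suc.prems \<open>0 \<le> h\<close>] by (simp add: sum_distrib_right[symmetric])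
    also have "(\<Sum>k\<in>E. d h i k) \<le> D h"
      unfolding D_def using Suc.prems finite_E by (intro member_le_sum) (auto simp: d_def intro: sum_nonneg)
    finally show ?case by (simp add: algebra_simps)
  qed
  have off: "((\<lambda>h. (p h (\<sigma> i) (\<sigma> j) - p h i j) / h) \<longlongrightarrow> 0) (at_right 0)"
    if "i \<in> E" "j \<in> E" "i \<noteq> j" for i j
    using tendsto_diff[OF lim[of "\<sigma> i" "\<sigma> j"] lim[of i j]] that \<sigma>E \<sigma>inj q
    by (simp add: diff_divide_distrib)
  have all: "((\<lambda>h. (p h (\<sigma> i) (\<sigma> j) - p h i j) / h) \<longlongrightarrow> 0) (at_right 0)"
    if "i \<in> E" "j \<in> E" for i j
  proof (cases "i = j")
    case True
    \<comment> \<open>Rows sum to 1, so the diagonal difference is minus the sum of the off-diagonal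
      ones.\<close>
    have "((\<lambda>h. - (\<Sum>k\<in>E - {i}. (p h (\<sigma> i) (\<sigma> k) - p h i k) / h)) \<longlongrightarrow> - (\<Sum>k\<in>E - {i}. 0)) (at_right 0)"
      by (intro tendsto_intros off) (use that in auto)
    moreover have "eventually (\<lambda>h. - (\<Sum>k\<in>E - {i}. (p h (\<sigma> i) (\<sigma> k) - p h i k) / h) =
        (p h (\<sigma> i) (\<sigma> i) - p h i i) / h) (at_right 0)"
      using eventually_at_right_less
    proof eventually_elim
      case (elim h)
      have "(\<Sum>k\<in>E. p h (\<sigma> i) (\<sigma> k) - p h i k) = 0"
        using sum\<sigma> sum_trans_prob elim \<sigma>E that by (simp add: sum_subtractf)
      then have "(p h (\<sigma> i) (\<sigma> i) - p h i i) = - (\<Sum>k\<in>E - {i}. p h (\<sigma> i) (\<sigma> k) - p h i k)"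
        using finite_E that by (simp add: sum.remove)
      then show ?case by (simp add: sum_divide_distrib[symmetric])
    qed
    ultimately show ?thesis using True by (simp add: tendsto_cong)
  qed (use off that in auto)
  have "((\<lambda>h. \<Sum>i\<in>E. \<Sum>j\<in>E. \<bar>(p h (\<sigma> i) (\<sigma> j) - p h i j) / h\<bar>) \<longlongrightarrow> (\<Sum>i\<in>E. \<Sum>j\<in>E. \<bar>0\<bar>)) (at_right 0)"
    by (intro tendsto_intros all)
  moreover have "eventually (\<lambda>h. (\<Sum>i\<in>E. \<Sum>j\<in>E. \<bar>(p h (\<sigma> i) (\<sigma> j) - p h i j) / h\<bar>) = D h / h) (at_right 0)"
    using eventually_at_right_less
    by eventually_elim (simp add: D_def d_def sum_divide_distrib)
  ultimately have D: "((\<lambda>h. D h / h) \<longlongrightarrow> 0) (at_right 0)" by (simp add: tendsto_cong)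
  show ?thesis
  proof (cases "t = 0")
    case True
    then show ?thesis using i j \<sigma>E \<sigma>inj by (simp add: trans_prob_0)
  next
    case False
    then have t: "0 < t" using t by simp
    \<comment> \<open>With \<open>h = t / real (Suc n)\<close>, the bound
      \<open>real (Suc n) * D h\<close> equals \<open>t * (D h / h)\<close>.\<close>
    have "filterlim (\<lambda>n. t / real (Suc n)) (at_right 0) sequentially"
      unfolding filterlim_at using t LIMSEQ_Suc[OF lim_const_over_n[of t]] by auto
    then have "(\<lambda>n. t * (D (t / real (Suc n)) / (t / real (Suc n)))) \<longlonglongrightarrow> t * 0"
      by (intro tendsto_intros filterlim_compose[OF D])
    then have "(\<lambda>n. real (Suc n) * D (t / real (Suc n))) \<longlonglongrightarrow> 0" using t by (simp add: mult.commute)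
    moreover have "d t i j \<le> real (Suc n) * D (t / real (Suc n))" for n
    proof -
      have "d t i j \<le> (\<Sum>j\<in>E. d t i j)"
        using j finite_E by (intro member_le_sum) (auto simp: d_def)
      also have "\<dots> \<le> real (Suc n) * D (t / real (Suc n))"
        using step[of i "t / real (Suc n)" "Suc n"] i t by simp
      finally show ?thesis .
    qed
    ultimately have "d t i j \<le> 0"
      by (intro LIMSEQ_le_const) auto
    then show ?thesis by (simp add: d_def)
  qed
qed

section \<open>Lumping, return times and irreducibility\<close>

text \<open>Strong lumpability: by \<open>lump\<close>, all states of a fibre send the same mass
  into any given fibre. In the path sum the last factor then depends on \<open>a m\<close> only and
  can be pulled out, although the lumped past does not determine the state
  \<open>b m\<close>.\<close>

lemma ctmc_lump:
  assumes st: "\<And>v. v \<in> f ` E \<Longrightarrow> st v \<in> E \<and> f (st v) = v"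
    and lump: "\<And>x y v t. x \<in> E \<Longrightarrow> y \<in> E \<Longrightarrow> f x = f y \<Longrightarrow> 0 \<le> t \<Longrightarrow>
      (\<Sum>z\<in>{z\<in>E. f z = v}. p t x z) = (\<Sum>z\<in>{z\<in>E. f z = v}. p t y z)"
  shows "ctmc (f ` E) (\<lambda>v. P (st v)) (\<lambda>t \<omega>. f (X t \<omega>))"
  unfolding ctmc_def
proof (intro conjI ballI allI impI)
  show "countable (f ` E)" using finite_E by (simp add: countable_finite)
  fix v assume v: "v \<in> f ` E"
  have stv: "st v \<in> E" "f (st v) = v" using st[OF v] by auto
  show "prob_space (P (st v))" using prob_space_P stv by simp
  show "(\<lambda>\<omega>. f (X t \<omega>)) \<in> measurable (P (st v)) (count_space (f ` E))" if "0 \<le> t" for t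
    by (rule measurable_compose[OF measurable_X[OF stv(1) that]]) auto
  show "\<exists>\<epsilon>>0. \<forall>s\<in>{t..<t + \<epsilon>}. f (X s \<omega>) = f (X t \<omega>)" if "0 \<le> t" "\<omega> \<in> space (P (st v))" for \<omega> t
  proof -
    have "\<exists>\<epsilon>>0. \<forall>s\<in>{t..<t + \<epsilon>}. X s \<omega> = X t \<omega>"
      using ctmc that stv(1) unfolding ctmc_def by blast
    then show ?thesis by metis
  qed
  have tp: "trans_prob (\<lambda>v. P (st v)) (\<lambda>t \<omega>. f (X t \<omega>)) t v w = (\<Sum>z\<in>{z\<in>E. f z = w}. p t (st v) z)"
    if "v \<in> f ` E" "0 \<le> t" for t v w
    using prob_eq_sum_trans_prob[of "st v" t "\<lambda>z. f z = w"] st that by (simp add: trans_prob_def)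
  show "trans_prob (\<lambda>v. P (st v)) (\<lambda>t \<omega>. f (X t \<omega>)) 0 v v = 1"
  proof -
    have "(\<Sum>z\<in>{z\<in>E. f z = v}. p 0 (st v) z) = (\<Sum>z\<in>{z\<in>E. f z = v}. of_bool (st v = z))"
      using stv by (intro sum.cong) (auto simp: trans_prob_0)
    also have "\<dots> = 1" using stv finite_E by (simp add: of_bool_def)
    finally show ?thesis by (simp add: tp v)
  qed
  fix m :: nat and t :: "nat \<Rightarrow> real" and a
  assume "0 \<le> t 0 \<and> (\<forall>k\<le>m. t k < t (Suc k)) \<and> (\<forall>k\<le>Suc m. a k \<in> f ` E)"
  then have t: "0 \<le> t 0" "\<And>k. k \<le> m \<Longrightarrow> t k < t (Suc k)" and a: "\<And>k. k \<le> Suc m \<Longrightarrow> a k \<in> f ` E" by auto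
  have tn: "0 \<le> t k" if "k \<le> m" for k
    by (rule increasing_nonneg[of t m]) (use t that le_SucI in blast)+
  let ?\<Phi> = "\<lambda>b. \<forall>k\<le>m. f (b k) = a k"
  let ?c = "\<lambda>b. measure (P (st v)) {\<omega> \<in> space (P (st v)). \<forall>k\<le>m. X (t k) \<omega> = b k}"
  \<comment> \<open>Evaluated from the representative \<open>st (a m)\<close>, which shares its
    fibre with every end point \<open>b m\<close> that occurs.\<close>
  let ?T = "trans_prob (\<lambda>v. P (st v)) (\<lambda>t \<omega>. f (X t \<omega>)) (t (Suc m) - t m) (a m) (a (Suc m))"
  have "measure (P (st v)) {\<omega> \<in> space (P (st v)). \<forall>k\<le>Suc m. f (X (t k) \<omega>) = a k} =
      measure (P (st v)) {\<omega> \<in> space (P (st v)). ?\<Phi> (\<lambda>k. X (t k) \<omega>) \<and> f (X (t (Suc m)) \<omega>) = a (Suc m)}"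
    by (intro arg_cong[where f = "measure (P (st v))"]) (auto simp: le_Suc_eq)
  also have "\<dots> = (\<Sum>b\<in>{b \<in> {..m} \<rightarrow>\<^sub>E E. ?\<Phi> b}. ?c b * (\<Sum>z\<in>{z\<in>E. f z = a (Suc m)}. p (t (Suc m) - t m) (b m) z))"
    by (rule prob_extend_paths[of "st v" t m ?\<Phi> "\<lambda>z. f z = a (Suc m)"]) (use stv t in auto)
  also have "\<dots> = (\<Sum>b\<in>{b \<in> {..m} \<rightarrow>\<^sub>E E. ?\<Phi> b}. ?c b * ?T)"
  proof (intro sum.cong refl arg_cong2[where f = times])
    fix b assume b: "b \<in> {b \<in> {..m} \<rightarrow>\<^sub>E E. ?\<Phi> b}"
    show "(\<Sum>z\<in>{z\<in>E. f z = a (Suc m)}. p (t (Suc m) - t m) (b m) z) = ?T"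
      using b st[OF a[of m]] t(2)[of m] a[of m] by (subst tp) (auto intro!: lump)
  qed
  also have "\<dots> = (\<Sum>b\<in>{b \<in> {..m} \<rightarrow>\<^sub>E E. ?\<Phi> b}. ?c b) * ?T" by (simp add: sum_distrib_right)
  also have "(\<Sum>b\<in>{b \<in> {..m} \<rightarrow>\<^sub>E E. ?\<Phi> b}. ?c b) =
      measure (P (st v)) {\<omega> \<in> space (P (st v)). \<forall>k\<le>m. f (X (t k) \<omega>) = a k}"
    by (rule prob_eq_sum_paths[of "st v" m t ?\<Phi>, symmetric]) (use stv tn in auto)
  finally show "measure (P (st v)) {\<omega> \<in> space (P (st v)). \<forall>k\<le>Suc m. f (X (t k) \<omega>) = a k} =
    measure (P (st v)) {\<omega> \<in> space (P (st v)). \<forall>k\<le>m. f (X (t k) \<omega>) = a k} * ?T" .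
qed

text \<open>Along the skeleton \<open>X 0, X T, X (2 * T), \<dots>\<close>, every pair of consecutive steps goes through
  \<open>j\<close> and back to \<open>i\<close> with conditional probability at least \<open>\<delta>\<^sup>2\<close>.\<close>

lemma return_time_integrable:
  assumes i: "i \<in> E" and j: "j \<in> E" "j \<noteq> i" and T: "0 < T" and \<delta>: "0 < \<delta>"
    and p: "\<And>k l. k \<in> E \<Longrightarrow> l \<in> E \<Longrightarrow> \<delta> \<le> p T k l"
  shows "(\<integral>\<^sup>+ \<omega>. return_time X i \<omega> \<partial>P i) < \<infinity>"
proof -
  interpret prob_space "P i" by (rule prob_space_P[OF i])
  define t where "t k = real k * T" for k :: nat
  \<comment> \<open>Failure of the first \<open>m\<close> trials, a trial being two steps of length
    \<open>T\<close>; success means \<open>j\<close> and then \<open>i\<close>. The visit to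
    \<open>j\<close> supplies the time outside \<open>i\<close> that \<open>return_time\<close> asks
    for.\<close>
  define \<Phi> where "\<Phi> m b \<longleftrightarrow> (\<forall>l<m. \<not> (b (Suc (2 * l)) = j \<and> b (Suc (Suc (2 * l))) = i))" for m and b :: "nat \<Rightarrow> 's"
  define N where "N m = {\<omega> \<in> space (P i). \<Phi> m (\<lambda>k. X (t k) \<omega>)}" for m
  have t: "0 \<le> t k" "t k < t (Suc k)" "t (Suc k) - t k = T" for k
    using T by (auto simp: t_def algebra_simps)
  have sets_t: "{\<omega> \<in> space (P i). X (t k) \<omega> = x} \<in> sets (P i)" for k x
    by (rule sets_X[OF i t(1)])
  have \<Phi>_cong: "\<Phi> m f = \<Phi> m g" if "\<And>k. k \<le> 2 * m \<Longrightarrow> f k = g k" for m f g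
    using that by (auto simp: \<Phi>_def)
  have sets_N [measurable]: "N m \<in> sets (P i)" for m
  proof -
    have "N m = space (P i) - (\<Union>l<m. {\<omega> \<in> space (P i). X (t (Suc (2 * l))) \<omega> = j} \<inter>
        {\<omega> \<in> space (P i). X (t (Suc (Suc (2 * l)))) \<omega> = i})"
      by (auto simp: N_def \<Phi>_def)
    also have "\<dots> \<in> sets (P i)" by (intro sets.Diff sets.top sets.finite_UN sets.Int sets_t) simp
    finally show ?thesis .
  qed
  have "prob (N (Suc m)) \<le> (1 - \<delta>\<^sup>2) * prob (N m)" for m
  proof -
    let ?\<Psi> = "\<lambda>b. \<Phi> m b \<and> b (Suc (2 * m)) = j"
    let ?A = "{\<omega> \<in> space (P i). ?\<Psi> (\<lambda>k. X (t k) \<omega>)}"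
    let ?B = "{\<omega> \<in> space (P i). ?\<Psi> (\<lambda>k. X (t k) \<omega>) \<and> X (t (Suc (Suc (2 * m)))) \<omega> = i}"
    have "\<delta> * prob (N m) \<le> prob ?A"
      unfolding N_def
    proof (rule prob_extend_paths_ge[of i t "2 * m" "\<Phi> m"])
      show "\<Phi> m f = \<Phi> m g" if "\<And>k. k \<le> 2 * m \<Longrightarrow> f k = g k" for f g
        by (rule \<Phi>_cong) (rule that)
    qed (use i j p t in auto)
    moreover have "\<delta> * prob ?A \<le> prob ?B"
    proof (rule prob_extend_paths_ge[of i t "Suc (2 * m)" ?\<Psi>])
      fix f g :: "nat \<Rightarrow> 's" assume "\<And>k. k \<le> Suc (2 * m) \<Longrightarrow> f k = g k"
      then show "?\<Psi> f = ?\<Psi> g" using \<Phi>_cong[of m f g] by auto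
    qed (use i p t in auto)
    ultimately have "\<delta> * (\<delta> * prob (N m)) \<le> prob ?B"
      using \<delta> by (meson mult_left_mono order.trans less_imp_le)
    moreover have "N (Suc m) = N m - ?B" "?B \<subseteq> N m"
      by (auto simp: N_def \<Phi>_def less_Suc_eq)
    moreover have "?B \<in> sets (P i)"
    proof -
      have "?B = N m \<inter> {\<omega> \<in> space (P i). X (t (Suc (2 * m))) \<omega> = j} \<inter> {\<omega> \<in> space (P i). X (t (Suc (Suc (2 * m)))) \<omega> = i}"
        by (auto simp: N_def)
      then show ?thesis using sets_t sets_N by auto
    qed
    ultimately show ?thesis
      by (simp add: finite_measure_Diff algebra_simps power2_eq_square)
  qed
  note rec = this
  \<comment> \<open>A lower bound for a probability is at most 1, so the ratio
    \<open>1 - \<delta>\<^sup>2\<close> is not negative.\<close>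
  have "\<delta> \<le> 1"
  proof -
    have "p T i i \<le> 1" unfolding trans_prob_def by simp
    then show ?thesis using p[OF i i] by simp
  qed
  then have \<delta>2: "0 \<le> 1 - \<delta>\<^sup>2" "1 - \<delta>\<^sup>2 < 1" using \<delta> by (auto simp: power_le_one)
  have pN: "prob (N m) \<le> (1 - \<delta>\<^sup>2) ^ m" for m
  proof (induction m)
    case (Suc m)
    have "prob (N (Suc m)) \<le> (1 - \<delta>\<^sup>2) * prob (N m)" by (rule rec)
    also have "\<dots> \<le> (1 - \<delta>\<^sup>2) * (1 - \<delta>\<^sup>2) ^ m" by (rule mult_left_mono[OF Suc \<delta>2(1)])
    finally show ?case by simp
  qed simp
  \<comment> \<open>If \<open>m\<close> is the first index with \<open>\<omega>\<close> outside
    \<open>N m\<close>, the sum is at least \<open>2 * T * m\<close>, and some success is complete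
    by that time; if there is no such index, the sum is infinite. The dominating sum is measurable,
    so the integral can be bounded without studying the measurability of
    \<open>return_time\<close>.\<close>
  have "return_time X i \<omega> \<le> (\<Sum>m. ennreal (2 * T) * indicator (N m) \<omega>)" if \<omega>: "\<omega> \<in> space (P i)" for \<omega>
  proof (cases "\<exists>m. \<omega> \<notin> N m")
    case False
    then have "(\<Sum>m. ennreal (2 * T) * indicator (N m) \<omega>) = (\<Sum>m. ennreal (2 * T))" by simp
    also have "\<dots> = \<infinity>" 
    proof (rule ccontr)
      assume "(\<Sum>m :: nat. ennreal (2 * T)) \<noteq> \<infinity>"
      then have "summable (\<lambda>m :: nat. 2 * T)"
        by (intro summable_suminf_not_top) (use T in simp_all)
      then show False using T by (simp add: summable_const_iff)
    qed
    finally show ?thesis by simp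
  next
    case True
    define m where "m = (LEAST m. \<omega> \<notin> N m)"
    have m: "\<omega> \<notin> N m" unfolding m_def using True by (rule LeastI_ex)
    have less: "\<omega> \<in> N l" if "l < m" for l using not_less_Least that unfolding m_def by blast
    obtain l where l: "l < m" "X (t (Suc (2 * l))) \<omega> = j" "X (t (Suc (Suc (2 * l)))) \<omega> = i"
      using m \<omega> by (auto simp: N_def \<Phi>_def)
    have "return_time X i \<omega> \<le> ennreal (t (Suc (Suc (2 * l))))"
      unfolding return_time_def
      by (rule INF_lower) (use l j t in \<open>auto intro!: exI[of _ "t (Suc (2 * l))"]\<close>)
    also have "\<dots> \<le> ennreal (real m * (2 * T))"
    proof (rule ennreal_leI)
      have "t (Suc (Suc (2 * l))) = real (Suc l) * (2 * T)" by (simp add: t_def algebra_simps)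
      also have "\<dots> \<le> real m * (2 * T)" using l T by (intro mult_right_mono) auto
      finally show "t (Suc (Suc (2 * l))) \<le> real m * (2 * T)" .
    qed
    also have "\<dots> = (\<Sum>k<m. ennreal (2 * T) * indicator (N k) \<omega>)"
      using less T by (simp add: ennreal_mult ennreal_of_nat_eq_real_of_nat)
    also have "\<dots> \<le> (\<Sum>k. ennreal (2 * T) * indicator (N k) \<omega>)"
      by (rule sum_le_suminf) auto
    finally show ?thesis .
  qed
  then have "(\<integral>\<^sup>+ \<omega>. return_time X i \<omega> \<partial>P i) \<le> (\<integral>\<^sup>+ \<omega>. (\<Sum>m. ennreal (2 * T) * indicator (N m) \<omega>) \<partial>P i)"
    by (rule nn_integral_mono)
  also have "\<dots> = (\<Sum>m. ennreal (2 * T) * emeasure (P i) (N m))"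
    by (subst nn_integral_suminf) (auto simp: nn_integral_cmult)
  also have "\<dots> \<le> (\<Sum>m. ennreal (2 * T * (1 - \<delta>\<^sup>2) ^ m))"
    using T pN \<delta>2 by (intro suminf_le) (auto simp: emeasure_eq_measure ennreal_mult[symmetric] intro!: ennreal_leI)
  also have "\<dots> < \<infinity>"
  proof -
    have "summable (\<lambda>m. 2 * T * (1 - \<delta>\<^sup>2) ^ m)"
      using \<delta>2 by (intro summable_mult summable_geometric) simp
    then have "(\<Sum>m. ennreal (2 * T * (1 - \<delta>\<^sup>2) ^ m)) \<noteq> \<top>"
      by (rule ennreal_suminf_neq_top) (use T \<delta>2 in simp)
    then show ?thesis by (simp add: less_top)
  qed
  finally show ?thesis .
qed

text \<open>Every pair has its own time \<open>\<tau> k l\<close>; waiting at \<open>l\<close> for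
  the rest, by \<open>self\<close>, gives one time \<open>T\<close> at which all entries are
  positive, and on a finite set the least entry serves as \<open>\<delta>\<close>.\<close>

lemma positive_recurrent:
  assumes irr: "irreducible_chain E P X" and two: "\<not> is_singleton E"
    and self: "\<And>i t. i \<in> E \<Longrightarrow> 0 \<le> t \<Longrightarrow> 0 < p t i i"
  shows "positive_recurrent E P X"
  unfolding positive_recurrent_def
proof
  fix i assume i: "i \<in> E"
  then obtain j where j: "j \<in> E" "j \<noteq> i" using two unfolding is_singleton_def by blast
  obtain \<tau> where \<tau>: "\<And>k l. k \<in> E \<Longrightarrow> l \<in> E \<Longrightarrow> 0 \<le> \<tau> k l \<and> 0 < p (\<tau> k l) k l"
    using irr unfolding irreducible_chain_def by metis
  \<comment> \<open>The sum dominates every \<open>\<tau> k l\<close>; the added 1 gives positivity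
    at once.\<close>
  define T where "T = 1 + (\<Sum>k\<in>E. \<Sum>l\<in>E. \<tau> k l)"
  have \<tau>_le: "\<tau> k l \<le> T" if "k \<in> E" "l \<in> E" for k l
  proof -
    have "\<tau> k l \<le> (\<Sum>l\<in>E. \<tau> k l)" using that \<tau> finite_E by (intro member_le_sum) auto
    also have "\<dots> \<le> (\<Sum>k\<in>E. \<Sum>l\<in>E. \<tau> k l)" using that \<tau> finite_E by (intro member_le_sum sum_nonneg) auto
    finally show ?thesis by (simp add: T_def)
  qed
  have "0 \<le> (\<Sum>k\<in>E. \<Sum>l\<in>E. \<tau> k l)" using \<tau> by (intro sum_nonneg) auto
  then have T: "0 < T" by (simp add: T_def)
  have pos: "0 < p T k l" if "k \<in> E" "l \<in> E" for k l
  proof -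
    have "0 < p (\<tau> k l) k l * p (T - \<tau> k l) l l" using \<tau> \<tau>_le self that by simp
    also have "\<dots> \<le> p (\<tau> k l + (T - \<tau> k l)) k l" using \<tau> \<tau>_le that by (intro trans_prob_add_ge) auto
    finally show ?thesis by simp
  qed
  let ?V = "(\<lambda>(k, l). p T k l) ` (E \<times> E)"
  have V: "finite ?V" "?V \<noteq> {}" using finite_E i by auto
  have "0 < Min ?V" using V pos by (subst Min_gr_iff) auto
  moreover have "Min ?V \<le> p T k l" if "k \<in> E" "l \<in> E" for k l using V that by (intro Min_le) auto
  ultimately show "(\<integral>\<^sup>+ \<omega>. return_time X i \<omega> \<partial>P i) < \<infinity>"
    using return_time_integrable[OF i j T, of "Min ?V"] by blast
qed

text \<open>\<open>st w\<close> is one state of the fibre of \<open>w\<close>, so positivity passes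
  from the server-level chain to the lumped one.\<close>

lemma trans_prob_lump_ge:
  assumes st: "\<And>v. v \<in> f ` E \<Longrightarrow> st v \<in> E \<and> f (st v) = v" and v: "v \<in> f ` E" "w \<in> f ` E" and t: "0 \<le> t"
  shows "p t (st v) (st w) \<le> trans_prob (\<lambda>v. P (st v)) (\<lambda>t \<omega>. f (X t \<omega>)) t v w"
proof -
  have "trans_prob (\<lambda>v. P (st v)) (\<lambda>t \<omega>. f (X t \<omega>)) t v w = (\<Sum>z\<in>{z\<in>E. f z = w}. p t (st v) z)"
    using prob_eq_sum_trans_prob[of "st v" t "\<lambda>z. f z = w"] st v t by (simp add: trans_prob_def)
  also have "p t (st v) (st w) \<le> \<dots>"
    using st v finite_E by (intro member_le_sum) (auto simp: trans_prob_nonneg)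
  finally show ?thesis .
qed

text \<open>A positive rate is the limit of \<open>p h j k / h\<close>, so \<open>p h j k\<close> is
  positive for some \<open>h\<close>; along a finite path such times add up by
  Chapman-Kolmogorov.\<close>

lemma irreducible_if_reachable:
  assumes lim: "\<And>i j. (i, j) \<in> R \<Longrightarrow> i \<in> E \<and> j \<in> E \<and> ((\<lambda>h. p h i j / h) \<longlongrightarrow> q i j) (at_right 0) \<and> 0 < q i j"
    and reach: "\<And>i j. i \<in> E \<Longrightarrow> j \<in> E \<Longrightarrow> (i, j) \<in> R\<^sup>*"
  shows "irreducible_chain E P X"
  unfolding irreducible_chain_def
proof (intro ballI)
  fix i j assume i: "i \<in> E" and "j \<in> E"
  then have "(i, j) \<in> R\<^sup>*" by (rule reach)
  then show "\<exists>t\<ge>0. 0 < p t i j"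
  proof (induction rule: rtrancl_induct)
    case base
    then show ?case using i by (intro exI[of _ 0]) (simp add: trans_prob_0)
  next
    case (step j k)
    then obtain t where t: "0 \<le> t" "0 < p t i j" by auto
    have jk: "j \<in> E" "k \<in> E" using lim step.hyps by auto
    have "eventually (\<lambda>h. 0 < p h j k / h) (at_right 0)"
      using lim[OF step.hyps(2)] by (auto intro: order_tendstoD(1))
    then have "eventually (\<lambda>h. 0 < h \<and> 0 < p h j k / h) (at_right 0)"
      using eventually_at_right_less by (rule eventually_conj[rotated])
    then obtain h where h: "0 < h" "0 < p h j k / h"
      using eventually_happens[of _ "at_right (0::real)"] by force
    then have "0 < p t i j * p h j k" using t by (simp add: zero_less_divide_iff)
    also have "\<dots> \<le> p (t + h) i k" using i jk t h by (intro trans_prob_add_ge) auto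
    finally show ?case using t h by (intro exI[of _ "t + h"]) simp
  qed
qed

end


section \<open>The PULL system\<close>

definition relabel :: "('i \<Rightarrow> 'i) \<Rightarrow> ('i, 'r) pull_state \<Rightarrow> ('i, 'r) pull_state" where
  "relabel \<sigma> = (\<lambda>(Q, D). (Q \<circ> \<sigma>, D \<circ> \<sigma>))"

lemma relabel_inv:
  assumes "bij \<sigma>"
  shows "relabel \<sigma> (relabel (inv \<sigma>) S) = S" "relabel (inv \<sigma>) (relabel \<sigma> S) = S"
  using assms
  by (auto simp: relabel_def comp_assoc bij_is_inj bij_is_surj surj_iff[THEN iffD1] split: prod.split)

lemma relabel_eq_iff: "bij \<sigma> \<Longrightarrow> relabel \<sigma> S = relabel \<sigma> S' \<longleftrightarrow> S = S'"
  using relabel_inv(2) by metis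

lemma comp_upd: "inj \<sigma> \<Longrightarrow> (Q \<circ> \<sigma>)(i := v) = Q(\<sigma> i := v) \<circ> \<sigma>"
  by (auto simp: fun_eq_iff inj_eq)

text \<open>An update at \<open>i\<close> of the relabelled state is the relabelled update at
  \<open>\<sigma> i\<close>, so the rate formulas match after reindexing the servers by
  \<open>\<sigma>\<close>. The second form is for services that leave the pull-messages
  alone.\<close>

lemma eq_relabel_upd_iff:
  assumes "bij \<sigma>"
  shows "relabel \<sigma> S = ((Q \<circ> \<sigma>)(i := a), (D \<circ> \<sigma>)(i := d)) \<longleftrightarrow> S = (Q(\<sigma> i := a), D(\<sigma> i := d))"
    and "relabel \<sigma> S = ((Q \<circ> \<sigma>)(i := a), D \<circ> \<sigma>) \<longleftrightarrow> S = (Q(\<sigma> i := a), D)"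
  using relabel_eq_iff[OF assms, of S "(Q(\<sigma> i := a), D(\<sigma> i := d))"]
    relabel_eq_iff[OF assms, of S "(Q(\<sigma> i := a), D)"] assms
  by (simp_all add: relabel_def comp_upd bij_is_inj)

lemma bij_betw_Collect_comp: "bij \<sigma> \<Longrightarrow> bij_betw \<sigma> {i. R (\<sigma> i)} {i. R i}"
  by (auto simp: bij_betw_def inj_on_def surj_def image_iff)

lemma card_Collect_comp: "bij \<sigma> \<Longrightarrow> card {i. R (\<sigma> i)} = card {i. R i}"
  by (rule bij_betw_same_card[OF bij_betw_Collect_comp])

lemma service_rate_relabel:
  fixes pool :: "'i::finite \<Rightarrow> 'j" and S S' :: "('i, 'r::finite) pull_state"
  assumes \<sigma>: "bij \<sigma>" and pool_comp: "pool \<circ> \<sigma> = pool"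
  shows "service_rate \<mu> pool (relabel \<sigma> S) (relabel \<sigma> S') = service_rate \<mu> pool S S'"
proof -
  have pool: "pool (\<sigma> i) = pool i" for i using fun_cong[OF pool_comp, of i] by simp
  obtain Q D where S: "S = (Q, D)" by (cases S)
  let ?g = "\<lambda>i. if Q i = 0 then 0
       else if Q i = 1 then
         (\<Sum>r\<in>UNIV. \<mu> (pool i) / real CARD('r) * of_bool (S' = (Q(i := 0), D(i := Some r))))
       else \<mu> (pool i) * of_bool (S' = (Q(i := Q i - 1), D))"
  have rS: "relabel \<sigma> S = (Q \<circ> \<sigma>, D \<circ> \<sigma>)" by (simp add: S relabel_def)
  have "service_rate \<mu> pool (relabel \<sigma> S) (relabel \<sigma> S') = (\<Sum>i\<in>UNIV. ?g (\<sigma> i))"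
    unfolding rS service_rate_def by (simp add: eq_relabel_upd_iff[OF \<sigma>] pool cong: if_cong)
  also have "\<dots> = (\<Sum>i\<in>UNIV. ?g i)" by (rule sum.reindex_bij_betw[OF \<sigma>])
  finally show ?thesis by (simp add: S service_rate_def)
qed

text \<open>Routers keep their names, so the terms agree router by router: \<open>\<sigma>\<close>
  maps \<open>?I' r\<close> onto \<open>?I r\<close>, preserving the number of candidates, and
  buffers agree because pools do.\<close>

lemma arrival_rate_relabel:
  fixes pool :: "'i::finite \<Rightarrow> 'j" and S S' :: "('i, 'r::finite) pull_state"
  assumes \<sigma>: "bij \<sigma>" and pool_comp: "pool \<circ> \<sigma> = pool"
  shows "arrival_rate ver \<Lambda> B pool (relabel \<sigma> S) (relabel \<sigma> S') = arrival_rate ver \<Lambda> B pool S S'"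
proof -
  have pool: "pool (\<sigma> i) = pool i" for i using fun_cong[OF pool_comp, of i] by simp
  obtain Q D where S: "S = (Q, D)" by (cases S)
  have rS: "relabel \<sigma> S = (Q \<circ> \<sigma>, D \<circ> \<sigma>)" by (simp add: S relabel_def)
  let ?I = "\<lambda>r. {i. D i = Some r}" and ?I' = "\<lambda>r. {i. (D \<circ> \<sigma>) i = Some r}"
  have bij: "bij_betw \<sigma> (?I' r) (?I r)" for r
    using bij_betw_Collect_comp[OF \<sigma>, of "\<lambda>i. D i = Some r"] by simp
  have card: "card (?I' r) = card (?I r)" for r by (rule bij_betw_same_card[OF bij])
  have empty: "?I' r = {} \<longleftrightarrow> ?I r = {}" for r
    using bij[of r] by (auto simp: bij_betw_def)
  have 1: "(\<Sum>i\<in>?I' r. \<Lambda> / real CARD('r) / real (card (?I' r)) *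
        of_bool (relabel \<sigma> S' = ((Q \<circ> \<sigma>)(i := 1), (D \<circ> \<sigma>)(i := None)))) =
      (\<Sum>i\<in>?I r. \<Lambda> / real CARD('r) / real (card (?I r)) * of_bool (S' = (Q(i := 1), D(i := None))))" for r
    unfolding eq_relabel_upd_iff[OF \<sigma>] card
    by (rule sum.reindex_bij_betw[OF bij])
  have 2: "(\<Sum>i\<in>UNIV. \<Lambda> / real CARD('r) / real CARD('i) *
        of_bool (enat ((Q \<circ> \<sigma>) i) < B (pool i) \<and>
          relabel \<sigma> S' = ((Q \<circ> \<sigma>)(i := (Q \<circ> \<sigma>) i + 1), (D \<circ> \<sigma>)(i := None)))) =
      (\<Sum>i\<in>UNIV. \<Lambda> / real CARD('r) / real CARD('i) *
        of_bool (enat (Q i) < B (pool i) \<and> S' = (Q(i := Q i + 1), D(i := None))))"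
    unfolding eq_relabel_upd_iff[OF \<sigma>]
    using sum.reindex_bij_betw[OF \<sigma>, of "\<lambda>i. \<Lambda> / real CARD('r) / real CARD('i) *
        of_bool (enat (Q i) < B (pool i) \<and> S' = (Q(i := Q i + 1), D(i := None)))"]
    by (simp add: pool)
  show ?thesis
    unfolding rS unfolding S arrival_rate_def prod.case 1 2 empty ..
qed

lemma pull_rate_relabel:
  assumes "bij \<sigma>" "pool \<circ> \<sigma> = pool"
  shows "pull_rate ver lam \<mu> B pool (relabel \<sigma> S) (relabel \<sigma> S') = pull_rate ver lam \<mu> B pool S S'"
  unfolding pull_rate_def service_rate_relabel[OF assms] arrival_rate_relabel[OF assms] ..

lemma bij_betw_relabel:
  assumes \<sigma>: "bij \<sigma>" and pool_comp: "pool \<circ> \<sigma> = pool"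
  shows "bij_betw (relabel \<sigma>) (pull_states B pool) (pull_states B pool)"
proof (rule bij_betw_byWitness[where f' = "relabel (inv \<sigma>)"])
  have pool: "pool (\<sigma> i) = pool i" for i using fun_cong[OF pool_comp, of i] by simp
  have pool': "pool (inv \<sigma> i) = pool i" for i
    using pool[of "inv \<sigma> i"] \<sigma> by (simp add: bij_is_surj surj_f_inv_f)
  show "relabel \<sigma> ` pull_states B pool \<subseteq> pull_states B pool"
    using pool by (auto simp: relabel_def pull_states_def) metis+
  show "relabel (inv \<sigma>) ` pull_states B pool \<subseteq> pull_states B pool"
    using pool' by (auto simp: relabel_def pull_states_def) metis+
qed (auto simp: relabel_inv[OF \<sigma>])

lemma mean_field_relabel:
  assumes \<sigma>: "bij \<sigma>" and pool_comp: "pool \<circ> \<sigma> = pool"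
  shows "mean_field pool (relabel \<sigma> S) = mean_field pool S"
proof -
  have pool: "pool (\<sigma> i) = pool i" for i using fun_cong[OF pool_comp, of i] by simp
  obtain Q D where S: "S = (Q, D)" by (cases S)
  have "card {i. pool i = j \<and> k \<le> Q (\<sigma> i)} = card {i. pool i = j \<and> k \<le> Q i}" for j k
    using card_Collect_comp[OF \<sigma>, of "\<lambda>i. pool i = j \<and> k \<le> Q i"] by (simp add: pool)
  moreover have "card {i. pool i = j \<and> Q (\<sigma> i) = 0 \<and> D (\<sigma> i) = Some r} =
      card {i. pool i = j \<and> Q i = 0 \<and> D i = Some r}" for j r
    using card_Collect_comp[OF \<sigma>, of "\<lambda>i. pool i = j \<and> Q i = 0 \<and> D i = Some r"] by (simp add: pool)
  ultimately show ?thesis by (simp add: S relabel_def mean_field_def)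
qed

text \<open>The mean-field value determines how many servers carry each label (pool, queue length,
  message): for busy servers by a difference of consecutive tails, for idle ones by
  \<open>\<xi>\<close>; all other labels are excluded in \<open>pull_states\<close>.\<close>

lemma card_pool_queue_message:
  fixes pool :: "'i::finite \<Rightarrow> 'j"
  assumes "(Q, D) \<in> pull_states B pool"
  shows "real (card {i. pool i = j \<and> Q i = k \<and> D i = d}) = real CARD('i) *
    (case d of None \<Rightarrow> if k = 0 then 0 else
        fst (mean_field pool (Q, D)) k j - fst (mean_field pool (Q, D)) (Suc k) j
     | Some r \<Rightarrow> if k = 0 then snd (mean_field pool (Q, D)) r j else 0)"
proof -
  have D: "D i = None \<longleftrightarrow> 0 < Q i" for i using assms by (simp add: pull_states_def)
  show ?thesis
  proof (cases d)
    case None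
    show ?thesis
    proof (cases "k = 0")
      case True
      then have "{i. pool i = j \<and> Q i = k \<and> D i = d} = {}" using None D by auto
      then show ?thesis using None True by (simp del: card_eq_0_iff)
    next
      case False
      have "{i. pool i = j \<and> Q i = k \<and> D i = d} = {i. pool i = j \<and> k \<le> Q i} - {i. pool i = j \<and> Suc k \<le> Q i}"
        using None D False by auto
      moreover have "{i. pool i = j \<and> Suc k \<le> Q i} \<subseteq> {i. pool i = j \<and> k \<le> Q i}" by auto
      ultimately have "real (card {i. pool i = j \<and> Q i = k \<and> D i = d}) =
          real (card {i. pool i = j \<and> k \<le> Q i}) - real (card {i. pool i = j \<and> Suc k \<le> Q i})"
        by (simp add: card_Diff_subset card_mono of_nat_diff)
      then show ?thesis using None False by (simp add: mean_field_def diff_divide_distrib[symmetric])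
    qed
  next
    case (Some r)
    show ?thesis
    proof (cases "k = 0")
      case True
      then show ?thesis using Some by (simp add: mean_field_def)
    next
      case False
      then have "D i = None" if "Q i = k" for i using that D[of i] by simp
      then have "{i. pool i = j \<and> Q i = k \<and> D i = d} = {}" using Some by auto
      then show ?thesis using Some False by (simp del: card_eq_0_iff)
    qed
  qed
qed

text \<open>Converse of \<open>mean_field_relabel\<close>: equal label counts make the two multisets
  of labels equal, hence some permutation matches the labels. The pool is part of the label, so
  pools are preserved.\<close>

lemma mean_field_eq_imp_relabel:
  fixes pool :: "'i::finite \<Rightarrow> 'j" and S S' :: "('i, 'r) pull_state"
  assumes S: "S \<in> pull_states B pool" "S' \<in> pull_states B pool"
    and eq: "mean_field pool S = mean_field pool S'"
  obtains \<sigma> where "bij \<sigma>" "pool \<circ> \<sigma> = pool" "S = relabel \<sigma> S'"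
proof -
  obtain Q D Q' D' where QD: "S = (Q, D)" "S' = (Q', D')" by (cases S, cases S')
  let ?f = "\<lambda>i. (pool i, Q i, D i)" and ?g = "\<lambda>i. (pool i, Q' i, D' i)"
  have "card {i. ?f i = x} = card {i. ?g i = x}" for x
  proof (cases x)
    case (fields j k d)
    have "real (card {i. pool i = j \<and> Q i = k \<and> D i = d}) =
        real (card {i. pool i = j \<and> Q' i = k \<and> D' i = d})"
      using S eq unfolding QD by (simp only: card_pool_queue_message)
    then show ?thesis using fields by simp
  qed
  then have "image_mset ?f (mset_set UNIV) = image_mset ?g (mset_set UNIV)"
    by (intro multiset_eqI) (simp add: count_image_mset_eq_card_vimage vimage_def eq_commute)
  then obtain \<sigma> where \<sigma>: "\<sigma> permutes UNIV" "\<forall>i. ?f i = ?g (\<sigma> i)"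
    by (auto intro: image_mset_eq_implies_permutes[OF finite])
  show ?thesis
  proof (rule that[of \<sigma>])
    show "bij \<sigma>" using \<sigma>(1) by (rule permutes_bij)
    show "pool \<circ> \<sigma> = pool" using \<sigma>(2) by (simp add: fun_eq_iff)
    show "S = relabel \<sigma> S'" using \<sigma>(2) by (auto simp: QD relabel_def fun_eq_iff)
  qed
qed

lemma service_rate_nonneg: "(\<And>j. 0 < \<mu> j) \<Longrightarrow> 0 \<le> service_rate \<mu> pool S S'"
  by (auto simp: service_rate_def less_imp_le intro!: sum_nonneg split: prod.split)

lemma arrival_rate_nonneg: "0 \<le> \<Lambda> \<Longrightarrow> 0 \<le> arrival_rate ver \<Lambda> B pool S S'"
  by (auto simp: arrival_rate_def intro!: sum_nonneg split: prod.split pull_version.split)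

section \<open>Reachability through jumps of positive rate\<close>

text \<open>\<open>s A\<close> stands for the state in which exactly the coordinates in
  \<open>A\<close> have been treated; being finitely many, they can be treated one by one.\<close>

lemma rtrancl_coordinatewise:
  fixes s :: "'a::finite set \<Rightarrow> 'b"
  assumes "\<And>A i. i \<notin> A \<Longrightarrow> (s A, s (insert i A)) \<in> R\<^sup>*"
  shows "(s {}, s UNIV) \<in> R\<^sup>*"
proof -
  have "(s {}, s A) \<in> R\<^sup>*" for A
    using finite[of A]
  proof induction
    case (insert i A)
    then show ?case using assms[of i A] by (meson rtrancl_trans)
  qed simp
  then show ?thesis .
qed

locale pull_system =
  fixes ver :: pull_version and lam :: real and \<mu> :: "'j \<Rightarrow> real" and B :: "'j \<Rightarrow> enat"
    and pool :: "'i::finite \<Rightarrow> 'j"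
  assumes lam: "0 < lam" and \<mu>: "\<And>j. 0 < \<mu> j" and B: "\<And>j. 1 \<le> B j"
    and PULL1: "ver = PULL1 \<Longrightarrow> B j = 1"
begin

lemma one_le_B: "enat (Suc 0) \<le> B j"
  using B[of j] by (simp add: one_enat_def)

text \<open>Restricted to distinct states, since \<open>ctmc_with_rates\<close> makes
  \<open>q i j\<close> a limit of \<open>p h i j / h\<close> only there.\<close>

definition steps :: "(('i, 'r::finite) pull_state \<times> ('i, 'r) pull_state) set" where
  "steps = {(S, S'). S \<in> pull_states B pool \<and> S' \<in> pull_states B pool \<and> S \<noteq> S' \<and>
     0 < pull_rate ver lam \<mu> B pool S S'}"

lemma pull_rate_pos_if_service: "0 < service_rate \<mu> pool S S' \<Longrightarrow> 0 < pull_rate ver lam \<mu> B pool S S'"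
  unfolding pull_rate_def using lam by (intro add_pos_nonneg arrival_rate_nonneg) auto

lemma pull_rate_pos_if_arrival:
  "0 < arrival_rate ver (lam * real CARD('i)) B pool S S' \<Longrightarrow> 0 < pull_rate ver lam \<mu> B pool S S'"
  unfolding pull_rate_def using \<mu> by (intro add_nonneg_pos service_rate_nonneg) auto

text \<open>Each router has the same positive chance of receiving the message, so \<open>r\<close>
  can be prescribed.\<close>

lemma service_step_idle:
  fixes D :: "'i \<Rightarrow> 'r::finite option"
  assumes S: "(Q, D) \<in> pull_states B pool" and Q: "Q i = 1"
  shows "((Q, D), (Q(i := 0), D(i := Some r))) \<in> steps"
proof -
  have "0 < service_rate \<mu> pool (Q, D) (Q(i := 0), D(i := Some r))"
    unfolding service_rate_def prod.case
  proof (rule sum_pos2[of _ i])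
    show "0 < (if Q i = 0 then 0
       else if Q i = 1 then \<Sum>r'\<in>UNIV. \<mu> (pool i) / real CARD('r) *
         of_bool ((Q(i := 0), D(i := Some r)) = (Q(i := 0), D(i := Some r')))
       else \<mu> (pool i) * of_bool ((Q(i := 0), D(i := Some r)) = (Q(i := Q i - 1), D)))"
      using Q \<mu> by (auto simp: less_imp_le intro!: sum_pos2[of _ r] divide_pos_pos)
  qed (auto simp: less_imp_le[OF \<mu>] intro!: sum_nonneg)
  moreover have "(Q(i := 0), D(i := Some r)) \<in> pull_states B pool"
    using S by (auto simp: pull_states_def zero_enat_def[symmetric])
  moreover have "Q \<noteq> Q(i := 0)" using Q by (metis fun_upd_same zero_neq_one)
  ultimately show ?thesis using S pull_rate_pos_if_service by (auto simp: steps_def)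
qed

lemma service_step_busy:
  fixes D :: "'i \<Rightarrow> 'r::finite option"
  assumes S: "(Q, D) \<in> pull_states B pool" and Q: "Q i = Suc (Suc n)"
  shows "((Q, D), (Q(i := Suc n), D)) \<in> steps"
proof -
  have "0 < service_rate \<mu> pool (Q, D) (Q(i := Suc n), D)"
    unfolding service_rate_def prod.case
  proof (rule sum_pos2[of _ i])
    show "0 < (if Q i = 0 then 0
       else if Q i = 1 then \<Sum>r\<in>UNIV. \<mu> (pool i) / real CARD('r) *
         of_bool ((Q(i := Suc n), D) = (Q(i := 0), D(i := Some r)))
       else \<mu> (pool i) * of_bool ((Q(i := Suc n), D) = (Q(i := Q i - 1), D)))"
      using Q \<mu> by auto
  qed (auto simp: less_imp_le[OF \<mu>] intro!: sum_nonneg)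
  moreover have "enat (Suc n) \<le> B (pool i)"
  proof -
    have "enat (Suc n) \<le> enat (Q i)" using Q by simp
    also have "\<dots> \<le> B (pool i)" using S by (simp add: pull_states_def)
    finally show ?thesis .
  qed
  then have "(Q(i := Suc n), D) \<in> pull_states B pool"
    using S Q by (auto simp: pull_states_def)
  moreover have "Q \<noteq> Q(i := Suc n)" using Q by (metis fun_upd_same n_not_Suc_n)
  ultimately show ?thesis using S pull_rate_pos_if_service by (auto simp: steps_def)
qed

text \<open>The message of \<open>i\<close> lies at some router \<open>r\<close>; under both
  versions an arrival at \<open>r\<close> picks \<open>i\<close> with positive probability.\<close>

lemma arrival_step_idle:
  fixes D :: "'i \<Rightarrow> 'r::finite option"
  assumes S: "(Q, D) \<in> pull_states B pool" and Q: "Q i = 0"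
  shows "((Q, D), (Q(i := 1), D(i := None))) \<in> steps"
proof -
  have "D i \<noteq> None" using S Q by (auto simp: pull_states_def)
  then obtain r where r: "D i = Some r" by auto
  let ?S = "(Q(i := 1), D(i := None))"
  let ?\<Lambda> = "lam * real CARD('i)"
  let ?in = "\<lambda>r. \<Sum>i\<in>{i. D i = Some r}. ?\<Lambda> / real CARD('r) / real (card {i. D i = Some r}) *
    of_bool (?S = (Q(i := 1), D(i := None)))"
  have "0 < ?in r"
    using r lam by (intro sum_pos2[of _ i]) (auto simp: card_gt_0_iff intro!: mult_pos_pos divide_pos_pos)
  then have "0 < arrival_rate ver ?\<Lambda> B pool (Q, D) ?S"
    unfolding arrival_rate_def prod.case using r lam
    by (intro sum_pos2[of _ r]) (auto intro!: sum_nonneg split: pull_version.split)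
  moreover have "?S \<in> pull_states B pool"
    using S one_le_B by (auto simp: pull_states_def)
  moreover have "Q \<noteq> Q(i := 1)" using Q by (metis fun_upd_same zero_neq_one)
  ultimately show ?thesis using S pull_rate_pos_if_arrival by (auto simp: steps_def)
qed

text \<open>Without any pull-message every router follows the rule of its version. Room above a
  positive queue forces a buffer of at least 2, which rules out \<open>PULL1\<close>;
  \<open>PULL2\<close> then picks \<open>i\<close> with positive probability.\<close>

lemma arrival_step_busy:
  fixes Q :: "'i \<Rightarrow> nat"
  assumes S: "(Q, \<lambda>_. None :: 'r::finite option) \<in> pull_states B pool" and Q: "enat (Suc (Q i)) \<le> B (pool i)"
  shows "((Q, \<lambda>_. None :: 'r option), (Q(i := Suc (Q i)), \<lambda>_. None)) \<in> steps"
proof -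
  have Qi: "0 < Q i" using S by (simp add: pull_states_def)
  have less: "enat (Q i) < B (pool i)" using Q by (metis Suc_ile_eq)
  have "ver = PULL2"
  proof (rule ccontr)
    assume "ver \<noteq> PULL2"
    then have "B (pool i) = 1" using PULL1 by (cases ver) auto
    then show False using less Qi by (simp add: one_enat_def)
  qed
  let ?S = "(Q(i := Suc (Q i)), \<lambda>_. None :: 'r option)"
  let ?\<Lambda> = "lam * real CARD('i)"
  have "0 < (\<Sum>i'\<in>UNIV. ?\<Lambda> / real CARD('r) / real CARD('i) *
      of_bool (enat (Q i') < B (pool i') \<and> ?S = (Q(i' := Q i' + 1), (\<lambda>_. None :: 'r option)(i' := None))))"
    using lam less by (intro sum_pos2[of _ i]) (auto simp: fun_upd_idem)
  then have "0 < arrival_rate ver ?\<Lambda> B pool (Q, \<lambda>_. None) ?S"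
    unfolding arrival_rate_def prod.case \<open>ver = PULL2\<close> by (simp add: sum_pos)
  moreover have "?S \<in> pull_states B pool" using S Q by (auto simp: pull_states_def)
  moreover have "Q \<noteq> Q(i := Suc (Q i))" by (metis fun_upd_same n_not_Suc_n)
  ultimately show ?thesis
    using S pull_rate_pos_if_arrival[of "(Q, \<lambda>_. None)" ?S] unfolding steps_def by blast
qed

text \<open>An idle server needs one arrival; a busy one is served down to length 1 and has no
  message throughout, so the update of \<open>D\<close> changes nothing.\<close>

lemma reach_one_at:
  assumes S: "(Q, D) \<in> pull_states B pool"
  shows "((Q, D), (Q(i := 1), D(i := None))) \<in> steps\<^sup>*"
proof (cases "Q i")
  case 0
  then show ?thesis using arrival_step_idle[OF S] by auto
next
  case (Suc n)
  then show ?thesis using S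
  proof (induction n arbitrary: Q)
    case 0
    then have "Q(i := 1) = Q" "D(i := None) = D" by (auto simp: pull_states_def fun_upd_idem_iff)
    then show ?case by simp
  next
    case (Suc n)
    then have step: "((Q, D), (Q(i := Suc n), D)) \<in> steps" by (intro service_step_busy) auto
    then have "(Q(i := Suc n), D) \<in> pull_states B pool" by (simp add: steps_def)
    then have "((Q(i := Suc n), D), ((Q(i := Suc n))(i := 1), D(i := None))) \<in> steps\<^sup>*"
      by (intro Suc.IH) (simp_all add: fun_upd_def)
    then have "((Q(i := Suc n), D), (Q(i := 1), D(i := None))) \<in> steps\<^sup>*"
      by (simp only: fun_upd_upd)
    with step show ?case by (rule converse_rtrancl_into_rtrancl)
  qed
qed

lemma reach_up_at:
  assumes S: "(Q, \<lambda>_. None :: 'r::finite option) \<in> pull_states B pool" and Q: "Q i = 1"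
    and k: "enat (Suc k) \<le> B (pool i)"
  shows "((Q, \<lambda>_. None :: 'r option), (Q(i := Suc k), \<lambda>_. None)) \<in> steps\<^sup>*"
  using k
proof (induction k)
  case 0
  have "Q(i := Suc 0) = Q" using Q by auto
  then show ?case by simp
next
  case (Suc k)
  have le: "enat (Suc k) \<le> B (pool i)"
    using Suc.prems by (meson Suc_ile_eq less_imp_le)
  then have "(Q(i := Suc k), \<lambda>_. None :: 'r option) \<in> pull_states B pool"
    using S by (auto simp: pull_states_def)
  from arrival_step_busy[OF this, of i] Suc.prems
  have "((Q(i := Suc k), \<lambda>_. None :: 'r option), (Q(i := Suc (Suc k)), \<lambda>_. None)) \<in> steps" by simp
  with Suc.IH[OF le] show ?case by (rule rtrancl_into_rtrancl)
qed

text \<open>The path goes through the state in which all queues have length \<open>1\<close>: busy servers can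
  receive customers only when some router holds no pull-message, which is certain there.\<close>

lemma reachable:
  fixes S S' :: "('i, 'r::finite) pull_state"
  assumes S: "S \<in> pull_states B pool" and S': "S' \<in> pull_states B pool"
  shows "(S, S') \<in> steps\<^sup>*"
proof -
  obtain Q D Q' D' where QD: "S = (Q, D)" "S' = (Q', D')" by (cases S, cases S')
  have Q: "enat (Q i) \<le> B (pool i)" "D i = None \<longleftrightarrow> 0 < Q i"
    and Q': "enat (Q' i) \<le> B (pool i)" "D' i = None \<longleftrightarrow> 0 < Q' i" for i
    using S S' by (auto simp: QD pull_states_def)
  \<comment> \<open>Servers that are to end idle are held at length 1 until the last phase, so that
    no pull-message is around while the others are raised to \<open>Q' i\<close>.\<close>
  have max: "enat (max 1 (Q' i)) \<le> B (pool i)" for i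
    using Q'(1)[of i] B[of "pool i"] by (simp add: max_def one_enat_def)
  \<comment> \<open>\<open>A\<close> holds the servers already treated in a phase: brought to length
    1 in \<open>s1\<close>, raised to \<open>max 1 (Q' i)\<close> in \<open>s2\<close>, put into the
    target condition in \<open>s3\<close>.\<close>
  define s1 :: "'i set \<Rightarrow> ('i, 'r) pull_state" where
    "s1 A = (\<lambda>i. if i \<in> A then 1 else Q i, \<lambda>i. if i \<in> A then None else D i)" for A
  define s2 :: "'i set \<Rightarrow> ('i, 'r) pull_state" where
    "s2 A = (\<lambda>i. if i \<in> A then max 1 (Q' i) else 1, \<lambda>_. None)" for A
  define s3 :: "'i set \<Rightarrow> ('i, 'r) pull_state" where
    "s3 A = (\<lambda>i. if i \<in> A then Q' i else max 1 (Q' i), \<lambda>i. if i \<in> A then D' i else None)" for A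
  have "(s1 {}, s1 UNIV) \<in> steps\<^sup>*"
  proof (rule rtrancl_coordinatewise)
    fix A i
    have "s1 A \<in> pull_states B pool" using Q one_le_B by (auto simp: s1_def pull_states_def)
    then have "(s1 A, ((fst (s1 A))(i := 1), (snd (s1 A))(i := None))) \<in> steps\<^sup>*"
      using reach_one_at[of "fst (s1 A)" "snd (s1 A)" i] by simp
    also have "((fst (s1 A))(i := 1), (snd (s1 A))(i := None)) = s1 (insert i A)"
      by (auto simp: s1_def fun_eq_iff)
    finally show "(s1 A, s1 (insert i A)) \<in> steps\<^sup>*" .
  qed
  also have "s1 UNIV = s2 {}" by (simp add: s1_def s2_def)
  also have "(s2 {}, s2 UNIV) \<in> steps\<^sup>*"
  proof (rule rtrancl_coordinatewise)
    fix A and i :: 'i assume i: "i \<notin> A"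
    have "s2 A \<in> pull_states B pool" using max one_le_B by (auto simp: s2_def pull_states_def)
    then have "(s2 A, ((fst (s2 A))(i := Suc (max 1 (Q' i) - 1)), \<lambda>_. None)) \<in> steps\<^sup>*"
      using reach_up_at[of "fst (s2 A)" i "max 1 (Q' i) - 1"] i max[of i] by (simp add: s2_def)
    also have "((fst (s2 A))(i := Suc (max 1 (Q' i) - 1)), \<lambda>_. None) = s2 (insert i A)"
      by (auto simp: s2_def fun_eq_iff)
    finally show "(s2 A, s2 (insert i A)) \<in> steps\<^sup>*" .
  qed
  also have "s2 UNIV = s3 {}" by (simp add: s2_def s3_def)
  also have "(s3 {}, s3 UNIV) \<in> steps\<^sup>*"
  proof (rule rtrancl_coordinatewise)
    fix A and i :: 'i assume i: "i \<notin> A"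
    show "(s3 A, s3 (insert i A)) \<in> steps\<^sup>*"
    proof (cases "D' i")
      case None
      \<comment> \<open>A server that is busy in the target is already in place, as
        \<open>max 1 (Q' i) = Q' i\<close>.\<close>
      then have "s3 (insert i A) = s3 A" using Q'(2)[of i] i by (auto simp: s3_def fun_eq_iff max_def)
      then show ?thesis by simp
    next
      case (Some r)
      have "s3 A \<in> pull_states B pool" using max Q' by (auto simp: s3_def pull_states_def)
      moreover have Q'i: "Q' i = 0" using Some Q'(2)[of i] by auto
      ultimately have "(s3 A, ((fst (s3 A))(i := 0), (snd (s3 A))(i := Some r))) \<in> steps"
        using service_step_idle[of "fst (s3 A)" "snd (s3 A)" i r] i by (simp add: s3_def)
      also have "((fst (s3 A))(i := 0), (snd (s3 A))(i := Some r)) = s3 (insert i A)"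
        using Q'i Some by (auto simp: s3_def fun_eq_iff)
      finally show ?thesis by auto
    qed
  qed
  finally have "(s1 {}, s3 UNIV) \<in> steps\<^sup>*" .
  then show ?thesis by (simp add: s1_def s3_def QD)
qed

end

section \<open>The mean-field chain\<close>

lemma finite_pull_states:
  fixes pool :: "'i::finite \<Rightarrow> 'j"
  assumes "\<And>j. B j < \<infinity>"
  shows "finite (pull_states B pool :: ('i, 'r::finite) pull_state set)"
proof -
  have "Q i \<le> the_enat (B (pool i))" if "enat (Q i) \<le> B (pool i)" for Q :: "'i \<Rightarrow> nat" and i
    using that assms[of "pool i"] by (cases "B (pool i)") auto
  then have "(pull_states B pool :: ('i, 'r) pull_state set) \<subseteq>
      (\<Pi>\<^sub>E i\<in>UNIV. {..the_enat (B (pool i))}) \<times> UNIV"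
    by (auto simp: pull_states_def PiE_iff)
  moreover have "finite ((\<Pi>\<^sub>E i\<in>UNIV. {..the_enat (B (pool i))}) \<times> (UNIV :: ('i \<Rightarrow> 'r option) set))"
    by (intro finite_cartesian_product finite_PiE) auto
  ultimately show ?thesis by (rule finite_subset)
qed

text \<open>All servers busy and all servers idle give different tails at \<open>k = 1\<close>. Two
  values are needed because a return presupposes an excursion: in a one-point chain the return time
  is infinite.\<close>

lemma mean_field_not_singleton:
  fixes pool :: "'i::finite \<Rightarrow> 'j"
  assumes B: "\<And>j. 1 \<le> B j"
  shows "\<not> is_singleton (mean_field_states B pool TYPE('r))"
proof
  assume single: "is_singleton (mean_field_states B pool TYPE('r))"
  let ?busy = "(\<lambda>_. 1, \<lambda>_. None) :: ('i, 'r) pull_state"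
  let ?idle = "(\<lambda>_. 0, \<lambda>_. Some undefined) :: ('i, 'r) pull_state"
  have "?busy \<in> pull_states B pool" "?idle \<in> pull_states B pool"
    using B by (auto simp: pull_states_def zero_enat_def[symmetric] one_enat_def)
  then have "mean_field pool ?busy = mean_field pool ?idle"
    using single unfolding mean_field_states_def is_singleton_def by (metis imageI singletonD)
  \<comment> \<open>\<open>pool undefined\<close> is the pool of some server, hence nonempty, while
    equality at \<open>k = 1\<close> would make it empty.\<close>
  from arg_cong[OF this, of "\<lambda>v. fst v 1 (pool undefined)"]
  have "{i. pool i = pool undefined} = {}" by (simp add: mean_field_def)
  then show False by blast
qed

theorem lemma2:
  fixes ver :: pull_version
    and lam :: real
    and \<beta> \<mu> :: "'j::finite \<Rightarrow> real"
    and B :: "'j \<Rightarrow> enat"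
    and pool :: "'i::finite \<Rightarrow> 'j"
    and P :: "('i, 'r::finite) pull_state \<Rightarrow> 'w measure"
    and S :: "real \<Rightarrow> 'w \<Rightarrow> ('i, 'r) pull_state"
    and st :: "(nat \<Rightarrow> 'j \<Rightarrow> real) \<times> ('r \<Rightarrow> 'j \<Rightarrow> real) \<Rightarrow> ('i, 'r) pull_state"
  assumes "lam > 0"
    and "\<forall>j. \<beta> j > 0"
    and "(\<Sum>j\<in>UNIV. \<beta> j) = 1"
    and "\<forall>j. \<mu> j > 0"
    and "lam < (\<Sum>j\<in>UNIV. \<beta> j * \<mu> j)"
    and "\<forall>j. real (card {i. pool i = j}) = \<beta> j * real CARD('i)"
    and "\<forall>j. B j \<ge> 1"
    and "ver = PULL1 \<longrightarrow> (\<forall>j. B j = 1)"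
    and "ctmc_with_rates (pull_states B pool) (pull_rate ver lam \<mu> B pool) P S"
    and "start_selection B pool st"
    and "\<forall>j. B j < \<infinity>"
  shows "ergodic_ctmc (mean_field_states B pool TYPE('r))
           (\<lambda>v. P (st v)) (\<lambda>t \<omega>. mean_field pool (S t \<omega>))"
proof -
  let ?E = "pull_states B pool :: ('i, 'r) pull_state set"
  let ?f = "mean_field pool :: ('i, 'r) pull_state \<Rightarrow> _"
  let ?q = "pull_rate ver lam \<mu> B pool"
  have ctmc: "ctmc ?E P S"
    and lim: "\<And>x y. x \<in> ?E \<Longrightarrow> y \<in> ?E \<Longrightarrow> x \<noteq> y \<Longrightarrow> ((\<lambda>h. trans_prob P S h x y / h) \<longlongrightarrow> ?q x y) (at_right 0)"
    and diag: "\<And>x. x \<in> ?E \<Longrightarrow> \<exists>c. ((\<lambda>h. (1 - trans_prob P S h x x) / h) \<longlongrightarrow> c) (at_right 0)"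
    using assms(9) unfolding ctmc_with_rates_def by blast+
  interpret finite_ctmc ?E P S
    by unfold_locales (use ctmc finite_pull_states assms(11) in auto)
  interpret pull_system ver lam \<mu> B pool
    by unfold_locales (use assms in auto)
  have E': "mean_field_states B pool TYPE('r) = ?f ` ?E" by (simp add: mean_field_states_def)
  have st: "st v \<in> ?E \<and> ?f (st v) = v" if "v \<in> ?f ` ?E" for v
    using assms(10) that unfolding start_selection_def E' by blast
  \<comment> \<open>With \<open>x = relabel \<sigma> y\<close>, the fibre of \<open>v\<close> is
    reindexed by \<open>relabel \<sigma>\<close>, which maps it onto itself; each term then equals
    the one for \<open>y\<close> by invariance of the transition probabilities.\<close>
  have lump: "(\<Sum>z\<in>{z\<in>?E. ?f z = v}. p t x z) = (\<Sum>z\<in>{z\<in>?E. ?f z = v}. p t y z)"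
    if xy: "x \<in> ?E" "y \<in> ?E" "?f x = ?f y" and t: "0 \<le> t" for x y v t
  proof -
    obtain \<sigma> where \<sigma>: "bij \<sigma>" "pool \<circ> \<sigma> = pool" and x: "x = relabel \<sigma> y"
      using mean_field_eq_imp_relabel[OF xy] by blast
    have bij: "bij_betw (relabel \<sigma>) ?E ?E" using \<sigma> by (rule bij_betw_relabel)
    have "bij_betw (relabel \<sigma>) {z\<in>?E. ?f z = v} {z\<in>?E. ?f z = v}"
    proof (rule bij_betw_imageI)
      show "inj_on (relabel \<sigma>) {z\<in>?E. ?f z = v}"
        by (rule inj_on_subset[OF bij_betw_imp_inj_on[OF bij]]) auto
      show "relabel \<sigma> ` {z\<in>?E. ?f z = v} = {z\<in>?E. ?f z = v}"
      proof (intro equalityI subsetI)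
        fix z assume "z \<in> relabel \<sigma> ` {z\<in>?E. ?f z = v}"
        then obtain w where "w \<in> ?E" "?f w = v" "z = relabel \<sigma> w" by blast
        then show "z \<in> {z\<in>?E. ?f z = v}"
          using bij_betwE[OF bij] mean_field_relabel[OF \<sigma>, of w] by simp
      next
        fix z assume z: "z \<in> {z\<in>?E. ?f z = v}"
        then obtain w where "w \<in> ?E" "z = relabel \<sigma> w"
          using bij_betw_imp_surj_on[OF bij] by blast
        then show "z \<in> relabel \<sigma> ` {z\<in>?E. ?f z = v}"
          using z mean_field_relabel[OF \<sigma>, of w] by simp
      qed
    qed
    then have "(\<Sum>z\<in>{z\<in>?E. ?f z = v}. p t x z) = (\<Sum>z\<in>{z\<in>?E. ?f z = v}. p t x (relabel \<sigma> z))"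
      by (rule sum.reindex_bij_betw[symmetric])
    also have "\<dots> = (\<Sum>z\<in>{z\<in>?E. ?f z = v}. p t y z)"
      unfolding x using xy(2) t
      by (intro sum.cong refl trans_prob_symmetric[OF bij lim pull_rate_relabel[OF \<sigma>]]) auto
    finally show ?thesis .
  qed
  \<comment> \<open>A finite limit of \<open>(1 - p h x x) / h\<close> forces \<open>p h x x\<close>
    to tend to 1, since \<open>h\<close> tends to 0.\<close>
  have "((\<lambda>h. p h x x) \<longlongrightarrow> 1) (at_right 0)" if x: "x \<in> ?E" for x
  proof -
    obtain c where "((\<lambda>h. (1 - p h x x) / h) \<longlongrightarrow> c) (at_right 0)" using diag[OF x] by blast
    then have "((\<lambda>h. 1 - h * ((1 - p h x x) / h)) \<longlongrightarrow> 1 - 0 * c) (at_right 0)"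
      by (intro tendsto_intros)
    moreover have "eventually (\<lambda>h. 1 - h * ((1 - p h x x) / h) = p h x x) (at_right 0)"
      using eventually_at_right_less by eventually_elim simp
    ultimately show ?thesis by (simp add: tendsto_cong)
  qed
  then have self: "0 < p t x x" if "x \<in> ?E" "0 \<le> t" for x t
    using trans_prob_self_pos that by blast
  have irr: "irreducible_chain ?E P S"
  proof (rule irreducible_if_reachable[of steps ?q])
    show "x \<in> ?E \<and> y \<in> ?E \<and> ((\<lambda>h. p h x y / h) \<longlongrightarrow> ?q x y) (at_right 0) \<and> 0 < ?q x y" if "(x, y) \<in> steps" for x y
      using that lim unfolding steps_def by blast
  qed (rule reachable)
  let ?P = "\<lambda>v. P (st v)" and ?X = "\<lambda>t \<omega>. ?f (S t \<omega>)"
  have ctmc': "ctmc (?f ` ?E) ?P ?X" by (rule ctmc_lump[OF st lump])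
  \<comment> \<open>The lumped process is a finite chain in its own right, so the recurrence
    argument applies to it directly.\<close>
  interpret L: finite_ctmc "?f ` ?E" ?P ?X
    by unfold_locales (use ctmc' finite_E in auto)
  have ge: "p t (st v) (st w) \<le> trans_prob ?P ?X t v w" if "v \<in> ?f ` ?E" "w \<in> ?f ` ?E" "0 \<le> t" for v w t
    using that by (intro trans_prob_lump_ge st)
  have irr': "irreducible_chain (?f ` ?E) ?P ?X"
    unfolding irreducible_chain_def
  proof (intro ballI)
    fix v w assume vw: "v \<in> ?f ` ?E" "w \<in> ?f ` ?E"
    then obtain t where "0 \<le> t" "0 < p t (st v) (st w)"
      using irr st unfolding irreducible_chain_def by blast
    then show "\<exists>t\<ge>0. 0 < trans_prob ?P ?X t v w" using ge[OF vw] by force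
  qed
  have "positive_recurrent (?f ` ?E) ?P ?X"
  proof (rule L.positive_recurrent[OF irr'])
    show "\<not> is_singleton (?f ` ?E)" unfolding E'[symmetric] by (rule mean_field_not_singleton[OF B])
    show "0 < trans_prob ?P ?X t v v" if "v \<in> ?f ` ?E" "0 \<le> t" for v t
    proof -
      have "0 < p t (st v) (st v)" using self st that by blast
      also have "\<dots> \<le> trans_prob ?P ?X t v v" using that by (intro ge)
      finally show ?thesis .
    qed
  qed
  with ctmc' irr' show ?thesis unfolding ergodic_ctmc_def E' by blast
qed

end
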